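(* Fix $d \geq 2$ and $n \geq 1$. Let $\varphi(t) = \frac12 t^2$ and $w_{ij} = 1$ for all $i,j$, so $f(X) = \frac14 \sum_{i,j}(x_i^\top x_j)^2$ on $\mathcal{M}$. Then every critical point of $f$ at which the Riemannian Hessian is negative semidefinite is a global maximum of $f$. In particular, local maxima are global maxima, these are exactly the configurations with $x_i = \pm x_j$ for all $i,j$, and gradient flow $\dot X = \mathrm{grad} f(X)$ converges to such a configuration from almost every initial condition in $\mathcal{M}$.
   Context: $\mathcal{M} = (\mathbb{S}^{d-1})^n$ is the set of $X \in \mathbb{R}^{d\times n}$ with unit-norm columns $x_1,\dots,x_n$, a Riemannian submanifold of $\mathbb{R}^{d\times n}$ with the Frobenius metric; gradient and Hessian are Riemannian; "almost every" is with respect to the uniform measure on $\mathcal{M}$. *)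

theory Defs
  imports "HOL-Analysis.Analysis"
begin

text \<open>A configuration X in R^(d x n) is an element of type real^'d^'n;
  its i-th column x_i is X$i.  The manifold M = (S^(d-1))^n.\<close>

definition sphere_prod :: "(real^'d^'n) set" where
  "sphere_prod = {X. \<forall>i. norm (X$i) = 1}"

definition tangent_space :: "real^'d^'n \<Rightarrow> (real^'d^'n) set" where
  "tangent_space X = {V. \<forall>i. X$i \<bullet> V$i = 0}"

definition proj_tangent :: "real^'d^'n \<Rightarrow> real^'d^'n \<Rightarrow> real^'d^'n" where
  "proj_tangent X Z = (\<chi> i. Z$i - (X$i \<bullet> Z$i) *\<^sub>R X$i)"

text \<open>Riemannian exponential map of M (product of great-circle geodesics).\<close>
definition exp_map :: "real^'d^'n \<Rightarrow> real^'d^'n \<Rightarrow> real^'d^'n" where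
  "exp_map X V = (\<chi> i. cos (norm (V$i)) *\<^sub>R X$i
                       + sin (norm (V$i)) *\<^sub>R (V$i /\<^sub>R norm (V$i)))"

definition egrad :: "(real^'d^'n \<Rightarrow> real) \<Rightarrow> real^'d^'n \<Rightarrow> real^'d^'n" where
  "egrad f X = (SOME G. (f has_derivative (\<lambda>H. G \<bullet> H)) (at X))"

definition rgrad :: "(real^'d^'n \<Rightarrow> real) \<Rightarrow> real^'d^'n \<Rightarrow> real^'d^'n" where
  "rgrad f X = proj_tangent X (egrad f X)"

definition rhess_form :: "(real^'d^'n \<Rightarrow> real) \<Rightarrow> real^'d^'n \<Rightarrow> real^'d^'n \<Rightarrow> real" where
  "rhess_form f X V = deriv (deriv (\<lambda>t. f (exp_map X (t *\<^sub>R V)))) 0"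

definition rhess_nsd :: "(real^'d^'n \<Rightarrow> real) \<Rightarrow> real^'d^'n \<Rightarrow> bool" where
  "rhess_nsd f X \<longleftrightarrow> (\<forall>V\<in>tangent_space X. rhess_form f X V \<le> 0)"

definition global_max_on_M :: "(real^'d^'n \<Rightarrow> real) \<Rightarrow> real^'d^'n \<Rightarrow> bool" where
  "global_max_on_M f X \<longleftrightarrow> X \<in> sphere_prod \<and> (\<forall>Y\<in>sphere_prod. f Y \<le> f X)"

definition local_max_on_M :: "(real^'d^'n \<Rightarrow> real) \<Rightarrow> real^'d^'n \<Rightarrow> bool" where
  "local_max_on_M f X \<longleftrightarrow> X \<in> sphere_prod \<and>
     (\<exists>e>0. \<forall>Y\<in>sphere_prod. dist Y X < e \<longrightarrow> f Y \<le> f X)"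

definition fobj :: "real^'d^'n \<Rightarrow> real" where
  "fobj X = (1/4) * (\<Sum>i\<in>UNIV. \<Sum>j\<in>UNIV. (X$i \<bullet> X$j)^2)"

definition grad_flow_solution ::
  "(real^'d^'n \<Rightarrow> real) \<Rightarrow> (real \<Rightarrow> real^'d^'n) \<Rightarrow> bool" where
  "grad_flow_solution f \<Phi> \<longleftrightarrow>
     (\<forall>t\<ge>0. (\<Phi> has_vector_derivative rgrad f (\<Phi> t)) (at t within {0..}))"

text \<open>Column normalisation Z \<mapsto> (z_i/|z_i|)_i.  The uniform measure on M is the
  push-forward of the standard Gaussian (equivalently, up to null sets, of Lebesgue
  measure) under this map, so "almost every X in M" is expressed as
  "Lebesgue-almost every Z, for X = col_normalize Z".\<close>
definition col_normalize :: "real^'d^'n \<Rightarrow> real^'d^'n" where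
  "col_normalize Z = (\<chi> i. Z$i /\<^sub>R norm (Z$i))"

end

theory Submission
  imports Defs
begin

text \<open>Write $S = \sum_j x_j x_j^T$, so that $f = |S|^2/4$ and the gradient has columns
  $S x_i - s_i x_i$ with $s_i = \langle x_i, S x_i\rangle$. Moving a single column $x_i$ along a unit
  vector $v \perp x_i$ changes $f$ to second order by $\langle v, S v\rangle - s_i + 1$. If $X$ is
  critical and $x_i \ne \pm x_j$, such a $v$ with $\langle v, S v\rangle \ge s_i$ is found in the plane
  of $x_i$ and $x_j$, because these are eigenvectors of $S$. Hence every critical point that is not a
  maximiser has a direction with second derivative at least $1$.

  For the flow, a gradient inequality $f(p) - f \le K |\mathrm{grad} f|^2$ near each critical point
  $p$ makes every trajectory converge to a critical point. Two trajectories that stay near a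
  non-maximal critical point cannot differ by a vector in a cone around the unstable direction, so
  the initial data of such trajectories lie on a Lipschitz graph over a hyperplane, which is a null
  set; a Lindeloef covering argument collects countably many of them.\<close>

section \<open>Critical points and maximisers\<close>

text \<open>The flow is never constructed: solutions enter only as given curves, every estimate
  compares two of them, and a backward Gronwall bound takes the place of an inverse flow map. For d
  >= 2 critical points are never isolated, since \<open>fobj\<close> is invariant under a common
  rotation of all columns, so their Hessians are degenerate. The gradient inequality therefore
  cannot come from nondegeneracy; it comes from the spectral gaps of S at the critical point, which
  conjugation by orthogonal matrices preserves. The same degeneracy shapes the instability argument:
  the Hessian is shifted by a small positive number that is not an eigenvalue, which makes it
  invertible, so that its square absorbs the nonlinear error, while the unstable direction stays
  strictly positive. Finally, "almost every" refers to the ambient space of Z and not to the product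
  of spheres; solutions are rescaled by the column norms of Z before the hyperplane argument, and it
  has to be shown that this rescaling hardly disturbs the unstable direction.\<close>

definition frame_op :: "real^'d^'n \<Rightarrow> real^'d \<Rightarrow> real^'d" where
  "frame_op X v = (\<Sum>j\<in>UNIV. (X$j \<bullet> v) *\<^sub>R X$j)"

text \<open>The Euclidean gradient of \<open>fobj\<close>, as \<open>egrad_fobj\<close>
  confirms.\<close>

definition frame_grad :: "real^'d^'n \<Rightarrow> real^'d^'n" where
  "frame_grad X = (\<chi> i. frame_op X (X$i))"

lemma frame_grad_nth [simp]: "frame_grad X $ i = frame_op X (X$i)"
  by (simp add: frame_grad_def)

lemma frame_op_adjoint: "u \<bullet> frame_op X v = frame_op X u \<bullet> v"
  unfolding frame_op_def inner_sum_left inner_sum_right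
  by (rule sum.cong) (auto simp: inner_commute mult.commute)

lemma inner_frame_op: "v \<bullet> frame_op X v = (\<Sum>j\<in>UNIV. (X$j \<bullet> v)^2)"
  unfolding frame_op_def inner_sum_right
  by (rule sum.cong) (auto simp: inner_commute power2_eq_square)

lemma linear_frame_op: "linear (frame_op X)"
  unfolding frame_op_def
  by (rule linearI) (simp_all add: inner_add_right scaleR_add_left sum.distrib scaleR_sum_right)

lemma fobj_has_derivative:
  fixes X :: "real^'d::finite^'n::finite"
  shows "(fobj has_derivative (\<lambda>H. frame_grad X \<bullet> H)) (at X)"
proof -
  have swap: "(\<Sum>i\<in>UNIV. \<Sum>j\<in>UNIV. (X$i \<bullet> X$j) * (X$i \<bullet> H$j)) = (\<Sum>i\<in>UNIV. \<Sum>j\<in>UNIV. (X$i \<bullet> X$j) * (H$i \<bullet> X$j))" for H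
    by (subst sum.swap) (simp add: inner_commute)
  have eq: "(1/4) * (\<Sum>i\<in>UNIV. \<Sum>j\<in>UNIV. 2 * (X$i \<bullet> X$j) * (X$i \<bullet> H$j + H$i \<bullet> X$j)) = frame_grad X \<bullet> H" for H
  proof -
    have "(1/4) * (\<Sum>i\<in>UNIV. \<Sum>j\<in>UNIV. 2 * (X$i \<bullet> X$j) * (X$i \<bullet> H$j + H$i \<bullet> X$j))
      = (1/2) * (\<Sum>i\<in>UNIV. \<Sum>j\<in>UNIV. (X$i \<bullet> X$j) * (X$i \<bullet> H$j) + (X$i \<bullet> X$j) * (H$i \<bullet> X$j))"
      by (simp add: sum_distrib_left algebra_simps)
    also have "\<dots> = (\<Sum>i\<in>UNIV. \<Sum>j\<in>UNIV. (X$i \<bullet> X$j) * (H$i \<bullet> X$j))"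
      by (simp add: sum.distrib swap)
    also have "\<dots> = frame_grad X \<bullet> H"
      unfolding inner_vec_def[of "frame_grad X"] frame_grad_nth frame_op_def inner_sum_left
      by (intro sum.cong) (auto simp: inner_commute)
    finally show ?thesis .
  qed
  have nth: "((\<lambda>Y::real^'d^'n. Y$i) has_derivative (\<lambda>H. H$i)) (at X)" for i
    by (rule bounded_linear_imp_has_derivative) (rule bounded_linear_vec_nth)
  have "(fobj has_derivative (\<lambda>H. (1/4) * (\<Sum>i\<in>UNIV. \<Sum>j\<in>UNIV. 2 * (X$i \<bullet> X$j) * (X$i \<bullet> H$j + H$i \<bullet> X$j)))) (at X)"
    unfolding fobj_def[abs_def]
    by (auto intro!: derivative_eq_intros nth ext sum.cong simp: algebra_simps)
  then show ?thesis unfolding eq .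
qed

text \<open>\<open>egrad\<close> is a choice: existence of one gradient makes the choice meaningful,
  and uniqueness of derivatives identifies it.\<close>

lemma egrad_fobj: "egrad fobj X = frame_grad X"
proof -
  have "(fobj has_derivative (\<lambda>H. egrad fobj X \<bullet> H)) (at X)"
    unfolding egrad_def by (rule someI[of _ "frame_grad X"]) (rule fobj_has_derivative)
  from has_derivative_unique[OF this fobj_has_derivative]
  have "egrad fobj X \<bullet> H = frame_grad X \<bullet> H" for H by meson
  then show ?thesis by (metis inner_commute vector_eq_rdot)
qed

lemma rgrad_fobj_nth:
  "rgrad fobj X $ i = frame_op X (X$i) - (X$i \<bullet> frame_op X (X$i)) *\<^sub>R X$i"
  by (simp add: rgrad_def proj_tangent_def egrad_fobj)

lemma rgrad_fobj_eq_0_iff: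
  "rgrad fobj X = 0 \<longleftrightarrow> (\<forall>i. frame_op X (X$i) = (X$i \<bullet> frame_op X (X$i)) *\<^sub>R X$i)"
  by (simp add: vec_eq_iff[of "rgrad fobj X"] rgrad_fobj_nth)

lemma sphere_prodD: "X \<in> sphere_prod \<Longrightarrow> norm (X$i) = 1"
  by (simp add: sphere_prod_def)

lemma sphere_prod_inner [simp]: "X \<in> sphere_prod \<Longrightarrow> X$i \<bullet> X$i = 1"
  by (simp add: sphere_prod_def dot_square_norm)

text \<open>Equality case of Cauchy-Schwarz: |x - y|^2 = 2 - 2 x.y and |x + y|^2 = 2 + 2 x.y, and
  one of the two vanishes.\<close>

lemma abs_inner_unit_eq_1:
  fixes x y :: "'a::real_inner"
  assumes "norm x = 1" "norm y = 1" "(x \<bullet> y)^2 = 1"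
  shows "x = y \<or> x = - y"
proof -
  have "x \<bullet> x = 1" "y \<bullet> y = 1" using assms by (simp_all add: dot_square_norm)
  then have "(norm (x - y))^2 = 2 - 2 * (x \<bullet> y)" "(norm (x + y))^2 = 2 + 2 * (x \<bullet> y)"
    unfolding power2_norm_eq_inner by (simp_all add: algebra_simps inner_commute)
  moreover have "x \<bullet> y = 1 \<or> x \<bullet> y = -1"
    using assms(3) by (simp add: power2_eq_1_iff)
  ultimately have "norm (x - y) = 0 \<or> norm (x + y) = 0" by fastforce
  then show ?thesis by (auto simp: eq_neg_iff_add_eq_0)
qed

lemma inner_square_le_1:
  fixes x y :: "'a::real_inner"
  assumes "norm x = 1" "norm y = 1"
  shows "(x \<bullet> y)^2 \<le> 1"
proof -
  have "\<bar>x \<bullet> y\<bar> \<le> 1" using Cauchy_Schwarz_ineq2[of x y] assms by simp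
  then show ?thesis by (simp only: abs_square_le_1)
qed

lemma fobj_le:
  fixes X :: "real^'d^'n"
  assumes "X \<in> sphere_prod"
  shows "fobj X \<le> (real CARD('n))^2 / 4"
proof -
  have "(\<Sum>i\<in>UNIV. \<Sum>j\<in>UNIV. (X$i \<bullet> X$j)^2) \<le> (\<Sum>i\<in>(UNIV::'n set). \<Sum>j\<in>(UNIV::'n set). 1)"
    using assms by (intro sum_mono inner_square_le_1 sphere_prodD)
  then show ?thesis by (simp add: fobj_def power2_eq_square)
qed

text \<open>Each of the n^2 summands is at most 1, so the bound of \<open>fobj_le\<close> is
  attained only if every summand equals 1.\<close>

lemma fobj_eq_max_iff:
  fixes X :: "real^'d^'n"
  assumes "X \<in> sphere_prod"
  shows "fobj X = (real CARD('n))^2 / 4 \<longleftrightarrow> (\<forall>i j. X$i = X$j \<or> X$i = - X$j)"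
proof -
  have le: "(X$i \<bullet> X$j)^2 \<le> 1" for i j
    using assms by (intro inner_square_le_1 sphere_prodD)
  have "fobj X = (real CARD('n))^2 / 4 \<longleftrightarrow> (\<Sum>i\<in>UNIV. \<Sum>j\<in>UNIV. 1 - (X$i \<bullet> X$j)^2) = 0"
    by (auto simp: fobj_def power2_eq_square sum_subtractf)
  also have "\<dots> \<longleftrightarrow> (\<forall>i j. (X$i \<bullet> X$j)^2 = 1)"
    by (simp add: sum_nonneg_eq_0_iff sum_nonneg le)
  also have "\<dots> \<longleftrightarrow> (\<forall>i j. X$i = X$j \<or> X$i = - X$j)"
  proof (intro iff_allI iffI)
    fix i j assume "(X$i \<bullet> X$j)^2 = 1"
    then show "X$i = X$j \<or> X$i = - X$j"
      using abs_inner_unit_eq_1 assms sphere_prodD by blast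
  next
    fix i j assume "X$i = X$j \<or> X$i = - X$j"
    then show "(X$i \<bullet> X$j)^2 = 1" using assms by auto
  qed
  finally show ?thesis .
qed

lemma global_max_fobj_iff:
  fixes X :: "real^'d^'n"
  assumes X: "X \<in> sphere_prod"
  shows "global_max_on_M fobj X \<longleftrightarrow> (\<forall>i j. X$i = X$j \<or> X$i = - X$j)"
proof
  obtain i0 :: 'n where True by simp
  \<comment> \<open>Repeating a single column attains the bound n^2/4, so a global maximum has to
    attain it as well.\<close>
  define Y :: "real^'d^'n" where "Y = (\<chi> i. X $ i0)"
  have "Y \<in> sphere_prod" using X by (simp add: Y_def sphere_prod_def)
  moreover from this have "fobj Y = (real CARD('n))^2 / 4"
    by (subst fobj_eq_max_iff) (auto simp: Y_def)
  moreover assume "global_max_on_M fobj X"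
  ultimately have "fobj X = (real CARD('n))^2 / 4"
    using fobj_le[OF X] by (force simp: global_max_on_M_def)
  then show "\<forall>i j. X$i = X$j \<or> X$i = - X$j" using fobj_eq_max_iff[OF X] by simp
next
  assume "\<forall>i j. X$i = X$j \<or> X$i = - X$j"
  then have "fobj X = (real CARD('n))^2 / 4" using fobj_eq_max_iff[OF X] by simp
  then have "fobj Y \<le> fobj X" if "Y \<in> sphere_prod" for Y :: "real^'d^'n"
    using fobj_le[OF that] by simp
  then show "global_max_on_M fobj X"
    using X by (auto simp: global_max_on_M_def intro: order_trans)
qed

text \<open>Two orthogonal columns serve as directions for each other; the one with the smaller
  eigenvalue is moved. Two non-orthogonal columns have the same eigenvalue because
  \<open>frame_op X\<close> is symmetric, so the part of one orthogonal to the other is again an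
  eigenvector for it.\<close>

lemma not_global_max_direction:
  fixes X :: "real^'d^'n"
  assumes X: "X \<in> sphere_prod" and crit: "rgrad fobj X = 0" and "\<not> global_max_on_M fobj X"
  obtains i v where "norm v = 1" "X$i \<bullet> v = 0" "v \<bullet> frame_op X v \<ge> X$i \<bullet> frame_op X (X$i)"
proof -
  define l where "l i = X$i \<bullet> frame_op X (X$i)" for i
  have eig: "frame_op X (X$i) = l i *\<^sub>R X$i" for i
    using crit by (simp add: rgrad_fobj_eq_0_iff l_def)
  obtain i j where ij: "X$i \<noteq> X$j" "X$i \<noteq> - X$j"
    using assms global_max_fobj_iff[OF X] by blast
  show ?thesis
  proof (cases "X$i \<bullet> X$j = 0")
    case True
    then show ?thesis
      using that[of "X$i" j] that[of "X$j" i] sphere_prodD[OF X] by (metis inner_commute linear)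
  next
    case False
    have "l i * (X$i \<bullet> X$j) = l j * (X$i \<bullet> X$j)"
      using frame_op_adjoint[of "X$j" X "X$i"] by (simp add: eig inner_commute)
    then have l: "l i = l j" using False by simp
    define w where "w = X$j - (X$i \<bullet> X$j) *\<^sub>R X$i"
    have w0: "w \<noteq> 0"
    proof
      assume "w = 0"
      then have eq: "X$j = (X$i \<bullet> X$j) *\<^sub>R X$i" by (simp add: w_def)
      then have "X$j \<bullet> X$j = (X$i \<bullet> X$j) * (X$i \<bullet> X$j)" by (metis inner_scaleR_left)
      then have "(X$i \<bullet> X$j)^2 = 1" using X by (simp add: power2_eq_square)
      then show False using abs_inner_unit_eq_1 ij sphere_prodD[OF X] by blast
    qed
    have fw: "frame_op X w = l i *\<^sub>R w"
      using linear_frame_op[of X] by (simp add: w_def linear_diff linear_scale eig l algebra_simps)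
    have "X$i \<bullet> w = 0" using X by (simp add: w_def inner_diff_right)
    moreover have "(w /\<^sub>R norm w) \<bullet> frame_op X (w /\<^sub>R norm w) = l i"
      using w0 linear_frame_op[of X]
      by (simp add: linear_scale fw dot_square_norm power2_eq_square field_simps)
    ultimately show ?thesis
      using that[of "w /\<^sub>R norm w" i] w0 by (simp add: l_def)
  qed
qed

section \<open>Varying a single column along a great circle\<close>

definition column_curve :: "real^'d^'n \<Rightarrow> 'n \<Rightarrow> real^'d \<Rightarrow> real \<Rightarrow> real^'d^'n" where
  "column_curve X i v t = (\<chi> k. if k = i then cos t *\<^sub>R X$i + sin t *\<^sub>R v else X$k)"

text \<open>\<open>exp_map\<close> divides by the norm of each tangent column. In the columns other
  than i, and at t = 0, that norm is 0 and the quotient is 0, which is harmless since the sine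
  factor vanishes too.\<close>

lemma exp_map_single_column:
  assumes "norm v = 1"
  shows "exp_map X (t *\<^sub>R (\<chi> k. if k = i then v else 0)) = column_curve X i v t"
  using assms by (cases "t = 0") (auto simp: exp_map_def column_curve_def vec_eq_iff abs_if)

lemma column_curve_in_sphere_prod:
  assumes "X \<in> sphere_prod" "norm v = 1" "X$i \<bullet> v = 0"
  shows "column_curve X i v t \<in> sphere_prod"
proof -
  have "v \<bullet> v = 1" using assms by (simp add: dot_square_norm)
  then have "(norm (cos t *\<^sub>R X$i + sin t *\<^sub>R v))^2 = (cos t)^2 + (sin t)^2"
    using assms
    unfolding power2_norm_eq_inner
    by (simp add: inner_add_left inner_add_right inner_commute power2_eq_square)
  then have "norm (cos t *\<^sub>R X$i + sin t *\<^sub>R v) = 1"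
    by (smt (verit) norm_ge_zero power2_eq_1_iff sin_cos_squared_add2)
  then show ?thesis using assms by (simp add: column_curve_def sphere_prod_def)
qed

text \<open>The formula is exact because, with its diagonal term fixed at 1, \<open>fobj\<close> is
  a quadratic polynomial in column i. The \<open>+ 1\<close> arises because
  \<open>frame_op X\<close> still contains the old column i, whose contribution cos^2 t has to be
  removed.\<close>

lemma fobj_column_curve:
  fixes X :: "real^'d^'n"
  assumes X: "X \<in> sphere_prod" and v: "norm v = 1" "X$i \<bullet> v = 0"
  shows "fobj (column_curve X i v t) = fobj X + sin t * cos t * (v \<bullet> frame_op X (X$i))
     + (sin t)^2 / 2 * (v \<bullet> frame_op X v - X$i \<bullet> frame_op X (X$i) + 1)"
proof -
  define Y where "Y = column_curve X i v t"
  have Y: "Y \<in> sphere_prod" unfolding Y_def by (rule column_curve_in_sphere_prod[OF assms])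
  have split: "(\<Sum>k\<in>UNIV. \<Sum>j\<in>UNIV. (Z$k \<bullet> Z$j)^2)
      = (\<Sum>k\<in>UNIV-{i}. \<Sum>j\<in>UNIV-{i}. (Z$k \<bullet> Z$j)^2) + 2 * (\<Sum>j\<in>UNIV-{i}. (Z$i \<bullet> Z$j)^2) + 1"
    if "Z \<in> sphere_prod" for Z :: "real^'d^'n"
  proof -
    have row: "(\<Sum>j\<in>UNIV. (Z$k \<bullet> Z$j)^2) = (Z$k \<bullet> Z$i)^2 + (\<Sum>j\<in>UNIV-{i}. (Z$k \<bullet> Z$j)^2)" for k
      by (rule sum.remove) auto
    have "(\<Sum>k\<in>UNIV. \<Sum>j\<in>UNIV. (Z$k \<bullet> Z$j)^2)
       = (\<Sum>j\<in>UNIV. (Z$i \<bullet> Z$j)^2) + (\<Sum>k\<in>UNIV-{i}. \<Sum>j\<in>UNIV. (Z$k \<bullet> Z$j)^2)"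
      by (rule sum.remove) auto
    moreover have "(\<Sum>k\<in>UNIV-{i}. (Z$k \<bullet> Z$i)^2) = (\<Sum>k\<in>UNIV-{i}. (Z$i \<bullet> Z$k)^2)"
      by (simp add: inner_commute)
    ultimately show ?thesis
      using that by (simp only: row sum.distrib sphere_prod_inner) simp
  qed
  have off: "Y$k = X$k" if "k \<noteq> i" for k using that by (simp add: Y_def column_curve_def)
  have Yi: "Y$i = cos t *\<^sub>R X$i + sin t *\<^sub>R v" by (simp add: Y_def column_curve_def)
  have "4 * fobj Y - 4 * fobj X = 2 * (\<Sum>j\<in>UNIV-{i}. (Y$i \<bullet> X$j)^2) - 2 * (\<Sum>j\<in>UNIV-{i}. (X$i \<bullet> X$j)^2)"
    using split[OF X] split[OF Y] by (simp add: fobj_def off add_divide_distrib)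
  also have "(\<Sum>j\<in>UNIV-{i}. (Y$i \<bullet> X$j)^2) = (\<Sum>j\<in>UNIV. (Y$i \<bullet> X$j)^2) - (Y$i \<bullet> X$i)^2"
    by (subst sum.remove[of UNIV i]) auto
  also have "Y$i \<bullet> X$i = cos t" using X v by (simp add: Yi inner_add_left inner_commute[of v])
  also have "(\<Sum>j\<in>UNIV-{i}. (X$i \<bullet> X$j)^2) = X$i \<bullet> frame_op X (X$i) - 1"
    unfolding inner_frame_op using X by (subst sum.remove[of UNIV i]) (auto simp: inner_commute)
  also have "(\<Sum>j\<in>UNIV. (Y$i \<bullet> X$j)^2) = Y$i \<bullet> frame_op X (Y$i)"
    by (simp add: inner_frame_op inner_commute)
  also have "\<dots> = (cos t)^2 * (X$i \<bullet> frame_op X (X$i)) + 2 * sin t * cos t * (v \<bullet> frame_op X (X$i))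
      + (sin t)^2 * (v \<bullet> frame_op X v)"
    using linear_frame_op[of X] frame_op_adjoint[of "X$i" X v]
    by (simp add: Yi linear_add linear_scale inner_add_left inner_add_right power2_eq_square inner_commute algebra_simps)
  finally show ?thesis unfolding Y_def[symmetric] by (simp add: cos_squared_eq field_simps)
qed

lemma rhess_fobj_single_column:
  fixes X :: "real^'d^'n"
  assumes X: "X \<in> sphere_prod" and v: "norm v = 1" "X$i \<bullet> v = 0"
  shows "rhess_form fobj X (\<chi> k. if k = i then v else 0)
           = v \<bullet> frame_op X v - X$i \<bullet> frame_op X (X$i) + 1"
proof -
  define a b where "a = v \<bullet> frame_op X (X$i)" and "b = v \<bullet> frame_op X v - X$i \<bullet> frame_op X (X$i) + 1"
  have "(\<lambda>t. fobj (exp_map X (t *\<^sub>R (\<chi> k. if k = i then v else 0)))) =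
     (\<lambda>t. fobj X + sin t * cos t * a + (sin t)^2 / 2 * b)"
    by (simp add: exp_map_single_column[OF v(1)] fobj_column_curve[OF assms] a_def b_def)
  moreover have "deriv (\<lambda>t. fobj X + sin t * cos t * a + (sin t)^2 / 2 * b)
      = (\<lambda>t. ((cos t)^2 - (sin t)^2) * a + sin t * cos t * b)"
    by (intro ext DERIV_imp_deriv) (auto intro!: derivative_eq_intros simp: power2_eq_square algebra_simps)
  moreover have "deriv (\<lambda>t. ((cos t)^2 - (sin t)^2) * a + sin t * cos t * b) 0 = b"
    by (intro DERIV_imp_deriv) (auto intro!: derivative_eq_intros)
  ultimately show ?thesis by (simp add: rhess_form_def b_def)
qed

lemma second_order_critical_imp_global_max:
  fixes X :: "real^'d^'n"
  assumes X: "X \<in> sphere_prod" and crit: "rgrad fobj X = 0" and nsd: "rhess_nsd fobj X"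
  shows "global_max_on_M fobj X"
proof (rule ccontr)
  assume "\<not> global_max_on_M fobj X"
  then obtain i v where v: "norm v = 1" "X$i \<bullet> v = 0" "v \<bullet> frame_op X v \<ge> X$i \<bullet> frame_op X (X$i)"
    using not_global_max_direction[OF X crit] by blast
  have "(\<chi> k. if k = i then v else 0) \<in> tangent_space X"
    using v by (simp add: tangent_space_def)
  then have "rhess_form fobj X (\<chi> k. if k = i then v else 0) \<le> 0"
    using nsd by (simp add: rhess_nsd_def)
  then show False using rhess_fobj_single_column[OF X v(1,2)] v(3) by simp
qed

text \<open>The first and second order conditions are both read off the exact formula for
  single-column variations; these directions already suffice for criticality and for the
  contradiction with \<open>not_global_max_direction\<close>.\<close>

lemma local_max_imp_global_max:
  fixes X :: "real^'d^'n"
  assumes "local_max_on_M fobj X"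
  shows "global_max_on_M fobj X"
proof -
  obtain e where X: "X \<in> sphere_prod" and e: "e > 0"
    and loc: "\<And>Y. Y \<in> sphere_prod \<Longrightarrow> dist Y X < e \<Longrightarrow> fobj Y \<le> fobj X"
    using assms by (auto simp: local_max_on_M_def)
  have key: "v \<bullet> frame_op X (X$i) = 0" "v \<bullet> frame_op X v + 1 \<le> X$i \<bullet> frame_op X (X$i)"
    if v: "norm v = 1" "X$i \<bullet> v = 0" for i v
  proof -
    define a b where "a = v \<bullet> frame_op X (X$i)" and "b = v \<bullet> frame_op X v - X$i \<bullet> frame_op X (X$i) + 1"
    define g where "g t = sin t * cos t * a + (sin t)^2 / 2 * b" for t
    have g: "fobj (column_curve X i v t) = fobj X + g t" for t
      by (simp add: fobj_column_curve[OF X v] a_def b_def g_def)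
    have "isCont (column_curve X i v) 0"
      unfolding column_curve_def[abs_def] isCont_def
      by (intro vec_tendstoI) (auto intro!: tendsto_eq_intros)
    moreover have c0: "column_curve X i v 0 = X" by (simp add: column_curve_def vec_eq_iff)
    ultimately have "\<exists>d>0. \<forall>t. dist t 0 < d \<longrightarrow> dist (column_curve X i v t) X < e"
      using e unfolding continuous_at_eps_delta by (metis)
    then obtain d where d: "d > 0" "\<And>t. dist t 0 < d \<Longrightarrow> dist (column_curve X i v t) X < e" by blast
    have gle: "g t \<le> 0" if "\<bar>t\<bar> < d" for t
      using loc[OF column_curve_in_sphere_prod[OF X v] d(2)[of t]] g[of t] that by (simp add: dist_real_def)
    have "(g has_real_derivative a) (at 0)"
      unfolding g_def[abs_def] by (auto intro!: derivative_eq_intros)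
    then have a0: "a = 0"
      by (rule DERIV_local_max[OF _ d(1)]) (use gle in \<open>auto simp: g_def\<close>)
    \<comment> \<open>One small t with sin t > 0 is enough: once a = 0, the value \<open>g t\<close>
      is a positive multiple of b.\<close>
    define t where "t = min (d/2) 1"
    have "t > 0" "\<bar>t\<bar> < d" "t \<le> 1" using d(1) by (auto simp: t_def min_def)
    moreover from this have "sin t > 0" by (intro sin_gt_zero) (use pi_gt3 in linarith)+
    ultimately have "b \<le> 0" using gle[of t] a0 by (simp add: g_def mult_le_0_iff)
    then show "v \<bullet> frame_op X (X$i) = 0" "v \<bullet> frame_op X v + 1 \<le> X$i \<bullet> frame_op X (X$i)"
      using a0 by (auto simp: a_def b_def)
  qed
  have "rgrad fobj X $ i = 0" for i
  proof (rule ccontr)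
    define w where "w = rgrad fobj X $ i"
    assume "rgrad fobj X $ i \<noteq> 0"
    then have w: "w \<noteq> 0" by (simp add: w_def)
    have perp: "X$i \<bullet> w = 0" using X by (simp add: w_def rgrad_fobj_nth inner_diff_right)
    \<comment> \<open>The gradient column is itself an admissible direction after normalisation, and
      its product with \<open>frame_op X (X$i)\<close> is its own squared norm.\<close>
    have "w \<bullet> frame_op X (X$i) = 0"
      using key(1)[of "w /\<^sub>R norm w" i] w perp by simp
    then have "w \<bullet> w = 0" using perp
      by (simp add: inner_commute w_def rgrad_fobj_nth inner_diff_right)
    then show False using w by simp
  qed
  then have crit: "rgrad fobj X = 0" by (simp add: vec_eq_iff[of "rgrad fobj X"])
  show ?thesis
  proof (rule ccontr)
    assume "\<not> global_max_on_M fobj X"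
    then obtain i v where "norm v = 1" "X$i \<bullet> v = 0" "v \<bullet> frame_op X v \<ge> X$i \<bullet> frame_op X (X$i)"
      using not_global_max_direction[OF X crit] by blast
    then show False using key(2) by fastforce
  qed
qed

section \<open>A gradient inequality at critical points\<close>

text \<open>Kernel and range of a symmetric map are orthogonal, so M is injective on its range and
  bounded below there; c is a spectral gap at 0. The quadratic form sees only the range component of
  x, so a kernel does no harm.\<close>

lemma symmetric_map_bounds:
  fixes M :: "'a::euclidean_space \<Rightarrow> 'a"
  assumes lin: "linear M" and sym: "\<And>x y. x \<bullet> M y = M x \<bullet> y"
  shows "\<exists>c>0. \<forall>x. c * \<bar>x \<bullet> M x\<bar> \<le> (norm (M x))^2 \<and> c * norm (M x) \<le> norm (M (M x))"
proof -
  have sub: "subspace (range M)" using lin by (simp add: linear_subspace_image)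
  have inj: "\<forall>x\<in>range M. M x = 0 \<longrightarrow> x = 0"
  proof safe
    fix x assume "M (M x) = 0"
    then have "M x \<bullet> M x = 0" using sym[of x "M x"] by simp
    then show "M x = 0" by simp
  qed
  obtain c where c: "c > 0" "\<And>x. x \<in> range M \<Longrightarrow> c * norm x \<le> norm (M x)"
    using injective_imp_isometric[OF closed_subspace[OF sub] sub _ inj] lin
    by (metis linear_conv_bounded_linear)
  have "c * \<bar>x \<bullet> M x\<bar> \<le> (norm (M x))^2" for x
  proof -
    obtain w z where wz: "w \<in> span (range M)" "\<And>u. u \<in> span (range M) \<Longrightarrow> orthogonal z u" "x = w + z"
      using orthogonal_subspace_decomp_exists by blast
    have w: "w \<in> range M" using wz(1) sub span_eq_iff by metis
    have "M z \<bullet> M z = z \<bullet> M (M z)" using sym by metis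
    also have "\<dots> = 0" using wz(2)[of "M (M z)"] by (simp add: span_base orthogonal_def)
    finally have Mz: "M z = 0" by simp
    have Mx: "M x = M w" using lin Mz by (simp add: wz(3) linear_add)
    have "x \<bullet> M x = w \<bullet> M w" unfolding Mx using sym[of x w] Mx sym[of w w] by simp
    then have "\<bar>x \<bullet> M x\<bar> \<le> norm w * norm (M w)" by (simp add: Cauchy_Schwarz_ineq2)
    then have "c * \<bar>x \<bullet> M x\<bar> \<le> (c * norm w) * norm (M w)" using c(1) by simp
    also have "\<dots> \<le> norm (M w) * norm (M w)" using c(2)[OF w] by (intro mult_right_mono) auto
    finally show ?thesis by (simp add: Mx power2_eq_square)
  qed
  then show ?thesis using c by blast
qed

section \<open>Square matrices with the Frobenius inner product\<close>

lemma inner_matrix_mult_left: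
  fixes A B C :: "real^'d::finite^'d"
  shows "A \<bullet> (B ** C) = (transpose B ** A) \<bullet> C"
proof -
  have "A \<bullet> (B ** C) = (\<Sum>i\<in>UNIV. \<Sum>j\<in>UNIV. \<Sum>k\<in>UNIV. A$i$j * (B$i$k * C$k$j))"
    by (simp add: inner_vec_def matrix_matrix_mult_def sum_distrib_left)
  also have "\<dots> = (\<Sum>i\<in>UNIV. \<Sum>k\<in>UNIV. \<Sum>j\<in>UNIV. A$i$j * (B$i$k * C$k$j))"
    by (intro sum.cong refl sum.swap)
  also have "\<dots> = (\<Sum>k\<in>UNIV. \<Sum>i\<in>UNIV. \<Sum>j\<in>UNIV. A$i$j * (B$i$k * C$k$j))"
    by (rule sum.swap)
  also have "\<dots> = (\<Sum>k\<in>UNIV. \<Sum>j\<in>UNIV. \<Sum>i\<in>UNIV. A$i$j * (B$i$k * C$k$j))"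
    by (intro sum.cong refl sum.swap)
  also have "\<dots> = (transpose B ** A) \<bullet> C"
    by (simp add: inner_vec_def matrix_matrix_mult_def transpose_def sum_distrib_left sum_distrib_right mult_ac)
  finally show ?thesis .
qed

lemma inner_transpose_transpose: "transpose A \<bullet> transpose B = (A :: real^'d::finite^'d) \<bullet> B"
  unfolding inner_vec_def transpose_def by (simp, rule sum.swap)

lemma inner_matrix_mult_right:
  fixes A B C :: "real^'d::finite^'d"
  shows "A \<bullet> (B ** C) = (A ** transpose C) \<bullet> B"
proof -
  have "A \<bullet> (B ** C) = transpose A \<bullet> (transpose C ** transpose B)"
    by (metis inner_transpose_transpose matrix_transpose_mul)
  also have "\<dots> = transpose (A ** transpose C) \<bullet> transpose B"
    by (simp only: inner_matrix_mult_left matrix_transpose_mul transpose_transpose)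
  finally show ?thesis by (simp only: inner_transpose_transpose)
qed

lemma norm_matrix_vector_mult_le:
  fixes A :: "real^'m::finite^'n::finite"
  shows "norm (A *v x) \<le> norm A * norm x"
proof -
  have "norm (A *v x) = L2_set (\<lambda>i. norm (A$i \<bullet> x)) UNIV"
    by (simp add: norm_vec_def[of "A *v x"] matrix_vector_mul_component)
  also have "\<dots> \<le> L2_set (\<lambda>i. norm (A$i) * norm x) UNIV"
    by (intro L2_set_mono) (auto simp: Cauchy_Schwarz_ineq2)
  also have "\<dots> = norm A * norm x"
    by (simp add: L2_set_left_distrib norm_vec_def[of A])
  finally show ?thesis .
qed

lemma bounded_bilinear_matrix_mult:
  "bounded_bilinear ((**) :: real^'d::finite^'d \<Rightarrow> _ \<Rightarrow> real^'d^'d)"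
  unfolding bilinear_conv_bounded_bilinear[symmetric] bilinear_def
  by (intro conjI allI linearI)
     (simp_all add: vec_eq_iff matrix_matrix_mult_def sum.distrib sum_distrib_left algebra_simps)

lemma bounded_linear_transpose: "bounded_linear (transpose :: real^'d::finite^'d \<Rightarrow> _)"
  unfolding linear_conv_bounded_linear[symmetric]
  by (intro linearI) (simp_all add: vec_eq_iff transpose_def)

lemmas continuous_on_matrix_mult =
  bounded_bilinear.continuous_on[OF bounded_bilinear_matrix_mult]

lemma compact_orthogonal_matrix: "compact {U :: real^'d::finite^'d. orthogonal_matrix U}"
proof -
  have "norm U \<le> norm (mat 1 :: real^'d^'d)" if "orthogonal_matrix U" for U :: "real^'d^'d"
  proof -
    have "U \<bullet> U = mat 1 \<bullet> (mat 1 :: real^'d^'d)"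
      using inner_matrix_mult_left[of U U "mat 1"] that by (simp add: orthogonal_matrix)
    then show ?thesis by (simp add: norm_eq_sqrt_inner)
  qed
  then have "bounded {U :: real^'d^'d. orthogonal_matrix U}"
    unfolding bounded_iff by blast
  moreover have "closed {U :: real^'d^'d. orthogonal_matrix U}"
    unfolding orthogonal_matrix
    by (intro closed_Collect_eq continuous_on_matrix_mult continuous_intros
        linear_continuous_on bounded_linear_transpose)
  ultimately show ?thesis by (simp add: compact_eq_bounded_closed)
qed

text \<open>Rodrigues' formula: since K^3 = -K, this matrix is the exponential of s K.\<close>

lemma skew_rotation_orthogonal:
  fixes K :: "real^'d::finite^'d"
  assumes "transpose K = - K" "K ** K ** K = - K"
  shows "orthogonal_matrix (mat 1 + sin s *\<^sub>R K + (1 - cos s) *\<^sub>R (K ** K))"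
proof -
  interpret mm: bounded_bilinear "(**) :: real^'d^'d \<Rightarrow> _ \<Rightarrow> real^'d^'d"
    by (rule bounded_bilinear_matrix_mult)
  interpret tr: bounded_linear "transpose :: real^'d^'d \<Rightarrow> _" by (rule bounded_linear_transpose)
  define J where "J = K ** K"
  have J: "K ** K = J" "J ** K = - K" "K ** J = - K" "J ** J = - J" "transpose J = J"
    using assms by (simp_all add: J_def matrix_mul_assoc mm.minus_left mm.minus_right matrix_transpose_mul)
  have trig: "(1 - cos s) + (1 - cos s) - (1 - cos s) * (1 - cos s) - sin s * sin s = 0"
    using sin_cos_squared_add3[of s] by (simp add: algebra_simps)
  have "transpose (mat 1 + sin s *\<^sub>R K + (1 - cos s) *\<^sub>R J) ** (mat 1 + sin s *\<^sub>R K + (1 - cos s) *\<^sub>R J)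
      = (mat 1 - sin s *\<^sub>R K + (1 - cos s) *\<^sub>R J) ** (mat 1 + sin s *\<^sub>R K + (1 - cos s) *\<^sub>R J)"
    using assms J by (simp add: tr.add tr.scaleR)
  also have "\<dots> = mat 1 + ((1 - cos s) + (1 - cos s) - (1 - cos s) * (1 - cos s) - sin s * sin s) *\<^sub>R J"
    by (simp add: mm.add_left mm.add_right mm.diff_left mm.diff_right mm.scaleR_left mm.scaleR_right J
        scaleR_add_left scaleR_diff_left)
       (simp add: vec_eq_iff algebra_simps)
  finally show ?thesis unfolding orthogonal_matrix trig J_def by simp
qed

text \<open>The orthogonal group is compact, so a maximiser exists. Stationarity under rotations in
  each coordinate plane makes the commutator of S and the conjugate orthogonal to all elementary
  skew matrices; being skew itself, it is 0.\<close>

lemma orthogonal_conjugate_maximizer: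
  fixes S P :: "real^'d::finite^'d"
  assumes symS: "transpose S = S" and symP: "transpose P = P"
  obtains U where "orthogonal_matrix U"
    "\<And>V. orthogonal_matrix V \<Longrightarrow> S \<bullet> (V ** P ** transpose V) \<le> S \<bullet> (U ** P ** transpose U)"
    "S ** (U ** P ** transpose U) = (U ** P ** transpose U) ** S"
proof -
  interpret mm: bounded_bilinear "(**) :: real^'d^'d \<Rightarrow> _ \<Rightarrow> real^'d^'d"
    by (rule bounded_bilinear_matrix_mult)
  interpret tr: bounded_linear "transpose :: real^'d^'d \<Rightarrow> _" by (rule bounded_linear_transpose)
  have "continuous_on {U. orthogonal_matrix U} (\<lambda>U. S \<bullet> (U ** P ** transpose U))"
    by (intro continuous_intros continuous_on_matrix_mult linear_continuous_on bounded_linear_transpose)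
  moreover have "{U :: real^'d^'d. orthogonal_matrix U} \<noteq> {}" using orthogonal_matrix_id by blast
  ultimately obtain U where U: "orthogonal_matrix U"
    "\<And>V. orthogonal_matrix V \<Longrightarrow> S \<bullet> (V ** P ** transpose V) \<le> S \<bullet> (U ** P ** transpose U)"
    using continuous_attains_sup[OF compact_orthogonal_matrix, of "\<lambda>U. S \<bullet> (U ** P ** transpose U)"]
    by auto
  define T where "T = U ** P ** transpose U"
  have symT: "transpose T = T" by (simp add: T_def matrix_transpose_mul symP matrix_mul_assoc)
  define C where "C = S ** T - T ** S"
  have trC: "transpose C = - C" by (simp add: C_def tr.diff matrix_transpose_mul symS symT)
  have "C $ j $ k = 0" for j k
  proof (cases "j = k")
    case True
    then show ?thesis using arg_cong[OF trC, of "\<lambda>M. M $ j $ k"] by (simp add: transpose_def)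
  next
    case False
    define E :: "'d \<Rightarrow> 'd \<Rightarrow> real^'d^'d" where "E a b = (\<chi> i l. if i = a \<and> l = b then 1 else 0)" for a b
    have E: "E a b ** E b' c = (if b = b' then E a c else 0)" for a b b' c
    proof -
      have "(\<Sum>m\<in>UNIV. E a b $ i $ m * E b' c $ m $ l) = (if b = b' then E a c else 0) $ i $ l" for i l
      proof -
        have "(\<Sum>m\<in>UNIV. E a b $ i $ m * E b' c $ m $ l)
           = (\<Sum>m\<in>UNIV. if m = b then (if b = b' then E a c else 0) $ i $ l else 0)"
          by (rule sum.cong) (auto simp: E_def)
        then show ?thesis by simp
      qed
      then show ?thesis by (simp add: vec_eq_iff matrix_matrix_mult_def)
    qed
    have trE: "transpose (E a b) = E b a" for a b
      unfolding E_def transpose_def by (intro vec_eq_iff[THEN iffD2] allI) simp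
    have Einner: "E a b \<bullet> M = M $ a $ b" for a b M
    proof -
      have "E a b \<bullet> M = (\<Sum>i\<in>UNIV. \<Sum>l\<in>UNIV. if i = a \<and> l = b then M $ i $ l else 0)"
        unfolding E_def inner_vec_def by (intro sum.cong) auto
      also have "\<dots> = (\<Sum>i\<in>UNIV. if i = a then M $ i $ b else 0)"
        by (intro sum.cong) (auto simp: sum.delta)
      finally show ?thesis by simp
    qed
    \<comment> \<open>The generator of rotations in the coordinate plane of j and k;
      \<open>R\<close> is the corresponding one-parameter rotation.\<close>
    define K where "K = E j k - E k j"
    have trK: "transpose K = - K"
      by (simp add: K_def tr.diff trE)
    have KKK: "K ** K ** K = - K"
      using False by (simp add: K_def mm.diff_left mm.diff_right E mm.add_left mm.minus_left)
    define R where "R s = mat 1 + sin s *\<^sub>R K + (1 - cos s) *\<^sub>R (K ** K)" for s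
    have R: "orthogonal_matrix (R s)" for s
      unfolding R_def by (rule skew_rotation_orthogonal[OF trK KKK])
    have R0: "R 0 = mat 1" by (simp add: R_def)
    have "((\<lambda>s. sin s *\<^sub>R K) has_vector_derivative K) (at 0)"
         "((\<lambda>s. (1 - cos s) *\<^sub>R (K ** K)) has_vector_derivative 0) (at 0)"
      by (auto intro!: derivative_eq_intros)
    then have R': "(R has_vector_derivative K) (at 0)"
      unfolding R_def[abs_def] by (auto intro!: derivative_eq_intros)
    define \<phi> where "\<phi> s = S \<bullet> (R s ** T ** transpose (R s))" for s
    have "((\<lambda>s. R s ** T ** transpose (R s)) has_vector_derivative
         (R 0 ** T) ** transpose K + (K ** T) ** transpose (R 0)) (at 0)"
      by (intro mm.has_vector_derivative tr.has_vector_derivative R'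
         bounded_linear.has_vector_derivative[OF mm.bounded_linear_left])
    then have "(\<phi> has_vector_derivative S \<bullet> (K ** T - T ** K)) (at 0)"
      unfolding \<phi>_def[abs_def]
      by (auto intro!: bounded_linear.has_vector_derivative[OF bounded_linear_inner_right]
          simp: R0 trK mm.minus_right)
    then have "(\<phi> has_real_derivative S \<bullet> (K ** T - T ** K)) (at 0)"
      by (simp add: has_real_derivative_iff_has_vector_derivative)
    moreover have "\<phi> s \<le> \<phi> 0" for s
    proof -
      have "\<phi> s = S \<bullet> ((R s ** U) ** P ** transpose (R s ** U))"
        by (simp add: \<phi>_def T_def matrix_transpose_mul matrix_mul_assoc)
      also have "\<dots> \<le> S \<bullet> T"
        unfolding T_def using R U(1) by (intro U(2) orthogonal_matrix_mul)
      finally show ?thesis by (simp add: \<phi>_def R0)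
    qed
    ultimately have "S \<bullet> (K ** T - T ** K) = 0"
      using DERIV_local_max[of \<phi> _ 0 1] by auto
    then have "K \<bullet> C = 0"
      by (simp add: C_def inner_diff_right inner_matrix_mult_right[of S K] inner_matrix_mult_left[of S T]
          symT inner_commute)
    then have "C $ j $ k - C $ k $ j = 0" by (simp add: K_def inner_diff_left Einner)
    moreover have "C $ k $ j = - C $ j $ k"
      using arg_cong[OF trC, of "\<lambda>M. M $ j $ k"] by (simp add: transpose_def)
    ultimately show ?thesis by simp
  qed
  then have "S ** T = T ** S" by (simp add: C_def vec_eq_iff)
  then show ?thesis using that U unfolding T_def by blast
qed

section \<open>The frame operator as a matrix\<close>

definition frame_matrix :: "real^'d^'n \<Rightarrow> real^'d^'d" where
  "frame_matrix X = (\<chi> a b. \<Sum>i\<in>UNIV. X$i$a * X$i$b)"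

lemma frame_matrix_vector_mult: "frame_matrix X *v v = frame_op X v"
proof -
  have "(frame_matrix X *v v) $ a = frame_op X v $ a" for a
  proof -
    have "(frame_matrix X *v v) $ a = (\<Sum>b\<in>UNIV. \<Sum>i\<in>UNIV. X$i$a * X$i$b * v$b)"
      by (simp add: frame_matrix_def matrix_vector_mult_def sum_distrib_right)
    also have "\<dots> = (\<Sum>i\<in>UNIV. \<Sum>b\<in>UNIV. X$i$a * X$i$b * v$b)" by (rule sum.swap)
    also have "\<dots> = frame_op X v $ a"
      by (simp add: frame_op_def inner_vec_def sum_distrib_right sum_distrib_left mult_ac)
    finally show ?thesis .
  qed
  then show ?thesis by (simp add: vec_eq_iff)
qed

lemma transpose_frame_matrix: "transpose (frame_matrix X) = frame_matrix X"
  by (simp add: vec_eq_iff transpose_def frame_matrix_def mult.commute)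

lemma inner_frame_matrix: "frame_matrix X \<bullet> T = (\<Sum>i\<in>UNIV. X$i \<bullet> (T *v X$i))"
proof -
  have "frame_matrix X \<bullet> T = (\<Sum>a\<in>UNIV. \<Sum>b\<in>UNIV. \<Sum>i\<in>UNIV. X$i$a * X$i$b * T$a$b)"
    by (simp add: frame_matrix_def inner_vec_def sum_distrib_right)
  also have "\<dots> = (\<Sum>a\<in>UNIV. \<Sum>i\<in>UNIV. \<Sum>b\<in>UNIV. X$i$a * X$i$b * T$a$b)"
    by (intro sum.cong refl sum.swap)
  also have "\<dots> = (\<Sum>i\<in>UNIV. \<Sum>a\<in>UNIV. \<Sum>b\<in>UNIV. X$i$a * X$i$b * T$a$b)"
    by (rule sum.swap)
  also have "\<dots> = (\<Sum>i\<in>UNIV. X$i \<bullet> (T *v X$i))"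
    by (simp add: inner_vec_def matrix_vector_mult_def sum_distrib_left mult_ac)
  finally show ?thesis .
qed

lemma fobj_frame_matrix: "fobj X = (norm (frame_matrix X))^2 / 4"
  by (simp add: power2_norm_eq_inner inner_frame_matrix frame_matrix_vector_mult inner_frame_op
      fobj_def inner_commute)

lemma inner_matrix_vector_mult_transpose:
  fixes A :: "real^'d::finite^'d"
  shows "x \<bullet> (A *v y) = (transpose A *v x) \<bullet> y"
  by (metis dot_lmul_matrix transpose_matrix_vector)

lemma norm_power2_columns: "(norm (X :: real^'d^'n))^2 = (\<Sum>i\<in>UNIV. (norm (X$i))^2)"
  unfolding power2_norm_eq_inner by (rule inner_vec_def)

lemma continuous_on_frame_matrix: "continuous_on A (frame_matrix :: real^'d::finite^'n::finite \<Rightarrow> _)"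
  unfolding frame_matrix_def[abs_def]
  by (intro continuous_on_vec_lambda continuous_intros)

text \<open>Near a critical point $X_*$ the eigenspaces of $S = XX^{T}$ are tracked by a conjugate $T$ of
  $S_* = X_*X_*^{T}$ that is closest to $S$: such a $T$ commutes with $S$. Then
  $4 f(X) = |S|^2 \ge 2\langle S, T\rangle - |T|^2$ reduces the deficit $f(X_*) - f(X)$ to a sum of
  squares $|(T - \lambda_i) x_i|^2$, and $(T - \lambda_i)$ maps the gradient to
  $(S - s_i)(T - \lambda_i) x_i$.\<close>
lemma gradient_inequality_at_critical:
  fixes P :: "real^'d::finite^'n::finite"
  assumes P: "P \<in> sphere_prod" and crit: "rgrad fobj P = 0"
  shows "\<exists>K>0. \<exists>r>0. \<forall>X\<in>sphere_prod. dist X P < r \<longrightarrow>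
            fobj P - fobj X \<le> K * (norm (rgrad fobj X))^2"
proof -
  define A where "A = frame_matrix P"
  define l where "l i = P$i \<bullet> frame_op P (P$i)" for i
  define M where "M i x = A *v x - l i *\<^sub>R x" for i x
  have symA: "transpose A = A" by (simp add: A_def transpose_frame_matrix)
  have linM: "linear (M i)" for i
    unfolding M_def by (intro linear_compose_sub matrix_vector_mul_linear linear_scale_self)
  have symM: "x \<bullet> M i y = M i x \<bullet> y" for i x y
    using inner_matrix_vector_mult_transpose[of x A y]
    by (simp add: M_def symA inner_diff_left inner_diff_right del: transpose_matrix_vector)
  have "\<exists>c>0. \<forall>x. c * \<bar>x \<bullet> M i x\<bar> \<le> (norm (M i x))^2 \<and> c * norm (M i x) \<le> norm (M i (M i x))" for i
    using symmetric_map_bounds[OF linM symM] .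
  then obtain c' where c': "\<And>i. c' i > 0" "\<And>i x. c' i * \<bar>x \<bullet> M i x\<bar> \<le> (norm (M i x))^2"
      "\<And>i x. c' i * norm (M i x) \<le> norm (M i (M i x))"
    by metis
  \<comment> \<open>One gap for all columns. Conjugation preserves it, so it serves every
    \<open>N i\<close> below, whatever X is.\<close>
  define c where "c = Min (range c')"
  have c0: "c > 0" and cle: "c \<le> c' i" for i
    using c'(1) by (auto simp: c_def)
  have c1: "c * \<bar>x \<bullet> M i x\<bar> \<le> (norm (M i x))^2" and c2: "c * norm (M i x) \<le> norm (M i (M i x))" for i x
    using c'(2,3)[of i x] cle[of i] mult_right_mono[of c "c' i" "\<bar>x \<bullet> M i x\<bar>"]
      mult_right_mono[of c "c' i" "norm (M i x)"] by auto
  define L where "L = norm A + (\<Sum>i\<in>UNIV. \<bar>l i\<bar>)"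
  have L: "norm A + \<bar>l i\<bar> \<le> L" for i
    unfolding L_def using member_le_sum[of i UNIV "\<lambda>i. \<bar>l i\<bar>"] by auto
  have L0: "L \<ge> 0" unfolding L_def by (intro add_nonneg_nonneg sum_nonneg) auto
  \<comment> \<open>\<open>D\<close> will bound |y_i| by the gradient column: replacing S and s_i by
    T and l_i costs c/12 + c/4 = c/3 of the gap c, which leaves more than c/2. The
    \<open>+ 1\<close> in \<open>K\<close> secures positivity.\<close>
  define D where "D = 2 * L / c"
  have D0: "D \<ge> 0" using c0 L0 by (simp add: D_def)
  define K where "K = D^2 / (2 * c) + 1"
  have K0: "K > 0" using c0 by (simp add: K_def add_nonneg_pos)
  have "isCont (\<lambda>X. frame_matrix X :: real^'d^'d) P"
    using continuous_on_frame_matrix[of UNIV] continuous_on_eq_continuous_at by blast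
  then obtain r1 where r1: "r1 > 0" "\<And>X. dist X P < r1 \<Longrightarrow> dist (frame_matrix X) A < c / 12"
    unfolding continuous_at_eps_delta A_def using c0 by (metis divide_pos_pos zero_less_numeral)

  have "isCont (\<lambda>X. X$i \<bullet> frame_op X (X$i)) P" for i
    unfolding frame_op_def by (intro continuous_intros)
  then have "((\<lambda>X. X$i \<bullet> frame_op X (X$i)) \<longlongrightarrow> l i) (nhds P)" for i
    using tendsto_at_iff_tendsto_nhds[of "\<lambda>X. X$i \<bullet> frame_op X (X$i)" P] by (simp add: isCont_def l_def)
  then have "\<forall>\<^sub>F X in nhds P. dist (X$i \<bullet> frame_op X (X$i)) (l i) < c / 4" for i
    using c0 by (intro tendstoD) auto
  then have "\<forall>\<^sub>F X in nhds P. \<forall>i. dist (X$i \<bullet> frame_op X (X$i)) (l i) < c / 4"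
    by (rule eventually_all_finite)
  then obtain r2 where r2: "r2 > 0"
    "\<And>X i. dist X P < r2 \<Longrightarrow> \<bar>X$i \<bullet> frame_op X (X$i) - l i\<bar> < c / 4"
    unfolding eventually_nhds_metric dist_real_def by blast
  have main: "fobj P - fobj X \<le> K * (norm (rgrad fobj X))^2"
    if X: "X \<in> sphere_prod" and dX: "dist X P < min r1 r2" for X
  proof -
    define S where "S = frame_matrix X"
    define s where "s i = X$i \<bullet> frame_op X (X$i)" for i
    have symS: "transpose S = S" by (simp add: S_def transpose_frame_matrix)
    obtain U where U: "orthogonal_matrix U"
      and Umax: "\<And>V. orthogonal_matrix V \<Longrightarrow> S \<bullet> (V ** A ** transpose V) \<le> S \<bullet> (U ** A ** transpose U)"
      and comm: "S ** (U ** A ** transpose U) = (U ** A ** transpose U) ** S"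
      using orthogonal_conjugate_maximizer[OF symS symA] by blast
    define T where "T = U ** A ** transpose U"
    have UtU: "transpose U ** U = mat 1" "U ** transpose U = mat 1"
      using U by (simp_all add: orthogonal_matrix_def)
    have normU: "norm (U *v z) = norm z" for z
    proof -
      have "(U *v z) \<bullet> (U *v z) = (transpose U ** U *v z) \<bullet> z"
        unfolding matrix_vector_mul_assoc[symmetric] by (rule inner_matrix_vector_mult_transpose)
      then show ?thesis by (simp add: UtU norm_eq_sqrt_inner)
    qed
    have "T \<bullet> T = (transpose U ** (U ** A ** transpose U) ** U) \<bullet> A"
      unfolding T_def inner_matrix_mult_left[of "U ** A ** transpose U" "U ** A" "transpose U", symmetric]
      using inner_matrix_mult_left[of "U ** A ** transpose U" U "A ** transpose U"]
        inner_matrix_mult_right[of "transpose U ** (U ** A ** transpose U)" A "transpose U"]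
      by (simp add: matrix_mul_assoc)
    also have "transpose U ** (U ** A ** transpose U) ** U = (transpose U ** U) ** A ** (transpose U ** U)"
      by (simp only: matrix_mul_assoc)
    finally have TT: "T \<bullet> T = A \<bullet> A" by (simp add: UtU)
    then have normT: "norm T = norm A" by (simp add: norm_eq_sqrt_inner)
    \<comment> \<open>The identity matrix competes in the maximisation, and T has the same norm as
      A; hence T is at least as close to S as A is.\<close>
    have "S \<bullet> A \<le> S \<bullet> T" using Umax[of "mat 1"] orthogonal_matrix_id by (simp add: T_def)
    then have "(norm (S - T))^2 \<le> (norm (S - A))^2"
      by (simp add: power2_norm_eq_inner inner_diff_left inner_diff_right TT inner_commute)
    then have ST: "norm (S - T) \<le> norm (S - A)" by (rule power2_le_imp_le) simp
    have SA: "norm (S - A) < c / 12" using r1(2)[of X] dX by (simp add: S_def dist_norm)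
    have sl: "\<bar>s i - l i\<bar> < c / 4" for i using r2(2)[of X i] dX by (simp add: s_def)
    define N where "N i x = T *v x - l i *\<^sub>R x" for i x
    have N: "N i x = U *v M i (transpose U *v x)" for i x
      by (simp add: N_def M_def T_def matrix_vector_mult_diff_distrib matrix_vector_mult_scaleR
          matrix_vector_mul_assoc matrix_mul_assoc UtU del: transpose_matrix_vector)
    have N1: "c * \<bar>x \<bullet> N i x\<bar> \<le> (norm (N i x))^2" for i x
      using c1[of "transpose U *v x" i]
      by (simp only: N normU inner_matrix_vector_mult_transpose[of x U])
    have N2: "c * norm (N i x) \<le> norm (N i (N i x))" for i x
    proof -
      have "N i (N i x) = U *v M i (M i (transpose U *v x))"
        by (simp add: N matrix_vector_mul_assoc UtU del: transpose_matrix_vector)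
      then show ?thesis using c2[of i "transpose U *v x"] by (simp only: N normU)
    qed
    define y where "y i = N i (X$i)" for i
    define \<rho> where "\<rho> i = rgrad fobj X $ i" for i
    have \<rho>: "\<rho> i = S *v X$i - s i *\<^sub>R X$i" for i
      by (simp add: \<rho>_def rgrad_fobj_nth S_def s_def frame_matrix_vector_mult)
    have y: "norm (y i) \<le> D * norm (\<rho> i)" for i
    proof -
      have ST_eq: "T *v (S *v x) = S *v (T *v x)" for x
        using comm by (simp add: T_def matrix_vector_mul_assoc)
      have Nr: "N i (\<rho> i) = S *v y i - s i *\<^sub>R y i"
        by (simp add: N_def \<rho> y_def ST_eq matrix_vector_mult_diff_distrib matrix_vector_mult_scaleR algebra_simps)
      have "norm (N i (\<rho> i)) \<le> norm T * norm (\<rho> i) + \<bar>l i\<bar> * norm (\<rho> i)"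
        unfolding N_def using norm_triangle_ineq4[of "T *v \<rho> i" "l i *\<^sub>R \<rho> i"]
          norm_matrix_vector_mult_le[of T "\<rho> i"] by simp
      also have "\<dots> \<le> L * norm (\<rho> i)"
        using L[of i] by (simp add: normT distrib_right[symmetric] mult_right_mono)
      finally have 1: "norm (N i (\<rho> i)) \<le> L * norm (\<rho> i)" .
      have "N i (y i) = N i (\<rho> i) - ((S - T) *v y i - (s i - l i) *\<^sub>R y i)"
        unfolding Nr by (simp add: N_def matrix_vector_mult_diff_rdistrib algebra_simps)
      then have "norm (N i (y i)) \<le> norm (N i (\<rho> i)) + norm ((S - T) *v y i) + norm ((s i - l i) *\<^sub>R y i)"
        by (smt (verit) norm_triangle_ineq4)
      moreover have "norm ((S - T) *v y i) \<le> (c / 12) * norm (y i)"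
        using norm_matrix_vector_mult_le[of "S - T" "y i"] ST SA
          mult_right_mono[of "norm (S - T)" "c / 12" "norm (y i)"] by simp
      moreover have "norm ((s i - l i) *\<^sub>R y i) \<le> (c / 4) * norm (y i)"
        using mult_right_mono[of "\<bar>s i - l i\<bar>" "c / 4" "norm (y i)"] sl[of i] by simp
      moreover have "c * norm (y i) \<le> norm (N i (y i))" unfolding y_def by (rule N2)
      moreover have "0 \<le> c * norm (y i)" using c0 by simp
      ultimately have "c * norm (y i) \<le> 2 * L * norm (\<rho> i)" using 1 by (simp add: field_simps)
      then show ?thesis using c0 by (simp add: D_def field_simps)
    qed
    have "c * (- (X$i \<bullet> y i)) \<le> D^2 * (norm (\<rho> i))^2" for i
    proof -
      have "c * (- (X$i \<bullet> y i)) \<le> c * \<bar>X$i \<bullet> y i\<bar>"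
        using c0 by (intro mult_left_mono) auto
      also have "\<dots> \<le> (norm (y i))^2" unfolding y_def by (rule N1)
      also have "\<dots> \<le> (D * norm (\<rho> i))^2" using y by (simp add: power_mono)
      finally show ?thesis by (simp add: power_mult_distrib)
    qed
    then have "(\<Sum>i\<in>UNIV. c * (- (X$i \<bullet> y i))) \<le> (\<Sum>i\<in>UNIV. D^2 * (norm (\<rho> i))^2)"
      by (intro sum_mono)
    then have Y: "- c * (\<Sum>i\<in>UNIV. X$i \<bullet> y i) \<le> D^2 * (norm (rgrad fobj X))^2"
      by (simp add: norm_power2_columns[of "rgrad fobj X"] \<rho>_def sum_distrib_left sum_negf)
    \<comment> \<open>Both A.A and S.T become sums over columns; as |x_i| = 1, they differ exactly
      by the sum of the x_i.y_i.\<close>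
    have AA: "A \<bullet> A = (\<Sum>i\<in>UNIV. l i)"
      by (simp add: A_def inner_frame_matrix frame_matrix_vector_mult l_def)
    have "S \<bullet> T = (\<Sum>i\<in>UNIV. X$i \<bullet> y i + l i)"
      unfolding S_def inner_frame_matrix y_def N_def
      using X by (intro sum.cong) (auto simp: inner_diff_right)
    then have "S \<bullet> T = (\<Sum>i\<in>UNIV. X$i \<bullet> y i) + A \<bullet> A" by (simp add: sum.distrib AA)
    moreover have "S \<bullet> S - 2 * (S \<bullet> T) + A \<bullet> A \<ge> 0"
      using inner_ge_zero[of "S - T"] by (simp add: inner_diff_left inner_diff_right TT inner_commute)
    moreover have "4 * fobj X = S \<bullet> S" "4 * fobj P = A \<bullet> A"
      by (simp_all add: fobj_frame_matrix S_def A_def power2_norm_eq_inner)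
    ultimately have "2 * (fobj P - fobj X) \<le> - (\<Sum>i\<in>UNIV. X$i \<bullet> y i)" by simp
    then have "c * (2 * (fobj P - fobj X)) \<le> c * (- (\<Sum>i\<in>UNIV. X$i \<bullet> y i))"
      using c0 by (intro mult_left_mono) auto
    also have "\<dots> \<le> D^2 * (norm (rgrad fobj X))^2" using Y by simp
    finally have "fobj P - fobj X \<le> D^2 / (2 * c) * (norm (rgrad fobj X))^2"
      using c0 by (simp add: field_simps)
    also have "\<dots> \<le> K * (norm (rgrad fobj X))^2" by (intro mult_right_mono) (auto simp: K_def)
    finally show ?thesis .
  qed
  show ?thesis
    using K0 r1(1) r2(1) main by (intro exI[of _ K] conjI exI[of _ "min r1 r2"]) auto
qed

section \<open>Convergence of the gradient flow\<close>

lemma has_derivative_vec_lambda: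
  fixes f :: "'a::euclidean_space \<Rightarrow> 'n::finite \<Rightarrow> 'b::real_normed_vector"
  assumes "\<And>i. ((\<lambda>x. f x i) has_derivative (\<lambda>h. f' h i)) (at x within S)"
  shows "((\<lambda>x. \<chi> i. f x i) has_derivative (\<lambda>h. \<chi> i. f' h i)) (at x within S)"
proof -
  have lin: "linear (\<lambda>h. f' h i)" for i
    using assms has_derivative_linear by blast
  have "linear (\<lambda>h. \<chi> i. f' h i)"
    by (rule linearI) (simp_all add: vec_eq_iff linear_add[OF lin] linear_scale[OF lin])
  then have "bounded_linear (\<lambda>h. \<chi> i. f' h i)" by (simp add: linear_conv_bounded_linear)
  moreover have "((\<lambda>y. (1 / norm (y - x)) *\<^sub>R ((\<chi> i. f y i) - ((\<chi> i. f x i) + (\<chi> i. f' (y - x) i)))) \<longlongrightarrow> 0)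
      (at x within S)"
    using assms by (intro vec_tendstoI) (simp add: has_derivative_within)
  ultimately show ?thesis by (simp add: has_derivative_within)
qed

text \<open>The derivative of \<open>frame_grad\<close>, that is, the Euclidean Hessian of
  \<open>fobj\<close>.\<close>

definition frame_hess :: "real^'d^'n \<Rightarrow> real^'d^'n \<Rightarrow> real^'d^'n" where
  "frame_hess X H = (\<chi> i. \<Sum>j\<in>UNIV. (X$j \<bullet> H$i + H$j \<bullet> X$i) *\<^sub>R X$j + (X$j \<bullet> X$i) *\<^sub>R H$j)"

text \<open>The ambient derivative of \<open>rgrad fobj\<close>, obtained by the product rule. At a
  critical point and on tangent vectors it becomes the symmetric \<open>crit_hess\<close>, see
  \<open>rgrad_deriv_tangent\<close>.\<close>

definition rgrad_deriv :: "real^'d^'n \<Rightarrow> real^'d^'n \<Rightarrow> real^'d^'n" where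
  "rgrad_deriv X H = (\<chi> i. frame_hess X H $ i
      - ((X$i \<bullet> frame_hess X H $ i + H$i \<bullet> frame_op X (X$i)) *\<^sub>R X$i
         + (X$i \<bullet> frame_op X (X$i)) *\<^sub>R H$i))"

lemma has_derivative_vec_nth: "((\<lambda>Y::real^'d::finite^'n::finite. Y$i) has_derivative (\<lambda>H. H$i)) (at X)"
  by (rule bounded_linear_imp_has_derivative) (rule bounded_linear_vec_nth)

lemma frame_op_has_derivative:
  fixes X :: "real^'d::finite^'n::finite"
  shows "((\<lambda>X. frame_op X (X$i)) has_derivative (\<lambda>H. frame_hess X H $ i)) (at X)"
  unfolding frame_op_def frame_hess_def
  by (auto intro!: derivative_eq_intros has_derivative_vec_nth ext sum.cong simp: algebra_simps)

lemma rgrad_fobj_has_derivative: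
  fixes X :: "real^'d::finite^'n::finite"
  shows "(rgrad fobj has_derivative rgrad_deriv X) (at X)"
proof -
  have eq: "rgrad fobj = (\<lambda>X::real^'d^'n. \<chi> i. frame_op X (X$i) - (X$i \<bullet> frame_op X (X$i)) *\<^sub>R X$i)"
    by (simp add: fun_eq_iff vec_eq_iff rgrad_fobj_nth)
  show ?thesis
    unfolding eq rgrad_deriv_def[abs_def]
    by (rule has_derivative_vec_lambda)
       (auto intro!: derivative_eq_intros has_derivative_vec_nth frame_op_has_derivative
         simp: algebra_simps)
qed

lemma continuous_on_rgrad_fobj: "continuous_on A (rgrad fobj :: real^'d::finite^'n::finite \<Rightarrow> _)"
  using rgrad_fobj_has_derivative has_derivative_continuous
  by (metis continuous_at_imp_continuous_on)

lemma nonneg_derivative_imp_le: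
  fixes g :: "real \<Rightarrow> real"
  assumes deriv: "\<And>t. t \<ge> 0 \<Longrightarrow> (g has_real_derivative g' t) (at t within {0..})"
    and nonneg: "\<And>t. t \<ge> a \<Longrightarrow> g' t \<ge> 0" and "0 \<le> a" "a \<le> s" "s \<le> t"
  shows "g s \<le> g t"
proof (cases "s = t")
  case False
  then have "s < t" using assms by simp
  have "(g has_derivative (*) (g' x)) (at x within {s..t})" if "s \<le> x" "x \<le> t" for x
    using has_derivative_subset[of g "(*) (g' x)" x "{0..}" "{s..t}"] deriv[of x] that assms
    by (auto simp: has_field_derivative_def)
  then obtain x where "x \<in> {s<..<t}" "g t - g s = g' x * (t - s)"
    using mvt_simple[OF \<open>s < t\<close>, of g "\<lambda>x. (*) (g' x)"] by blast
  moreover from this have "g' x * (t - s) \<ge> 0"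
    using nonneg[of x] assms \<open>s < t\<close> by (intro mult_nonneg_nonneg) auto
  ultimately show ?thesis by simp
qed simp

section \<open>Solutions of the gradient flow\<close>

lemma grad_flow_derivative:
  assumes "grad_flow_solution fobj \<Phi>" "t \<ge> 0"
  shows "(\<Phi> has_vector_derivative rgrad fobj (\<Phi> t)) (at t within {0..})"
  using assms by (simp add: grad_flow_solution_def)

text \<open>The defect u = 1 - |x_i|^2 satisfies u' = -2 a u with a = x_i.S x_i >= 0, so u^2 cannot
  grow from its initial value 0. The vector field is defined off the spheres as well, so invariance
  has to be proved.\<close>

lemma grad_flow_in_sphere_prod:
  fixes \<Phi> :: "real \<Rightarrow> real^'d::finite^'n::finite"
  assumes sol: "grad_flow_solution fobj \<Phi>" and init: "\<Phi> 0 \<in> sphere_prod" and "t \<ge> 0"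
  shows "\<Phi> t \<in> sphere_prod"
proof -
  have "norm (\<Phi> t $ i) = 1" for i
  proof -
    define a where "a t = \<Phi> t $ i \<bullet> frame_op (\<Phi> t) (\<Phi> t $ i)" for t
    define u where "u t = 1 - \<Phi> t $ i \<bullet> \<Phi> t $ i" for t
    have a0: "a t \<ge> 0" for t by (simp add: a_def inner_frame_op sum_nonneg)
    have comp: "((\<lambda>t. \<Phi> t $ i) has_vector_derivative rgrad fobj (\<Phi> t) $ i) (at t within {0..})"
      if "t \<ge> 0" for t
      using bounded_linear.has_vector_derivative[OF bounded_linear_vec_nth grad_flow_derivative[OF sol that]] .
    have u': "(u has_real_derivative - 2 * a t * u t) (at t within {0..})" if "t \<ge> 0" for t
    proof -
      have "(u has_vector_derivative 0 - (\<Phi> t $ i \<bullet> rgrad fobj (\<Phi> t) $ i + rgrad fobj (\<Phi> t) $ i \<bullet> \<Phi> t $ i))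
            (at t within {0..})"
        unfolding u_def[abs_def]
        by (intro has_vector_derivative_diff has_vector_derivative_const
            bounded_bilinear.has_vector_derivative[OF bounded_bilinear_inner] comp that)
      moreover have "\<Phi> t $ i \<bullet> rgrad fobj (\<Phi> t) $ i = a t * u t"
        by (simp add: rgrad_fobj_nth a_def u_def inner_diff_right algebra_simps)
      ultimately show ?thesis
        by (simp add: has_real_derivative_iff_has_vector_derivative inner_commute mult.assoc)
    qed
    define w where "w t = - ((u t)^2)" for t
    have "(w has_real_derivative 4 * a t * (u t)^2) (at t within {0..})" if "t \<ge> 0" for t
      unfolding w_def[abs_def]
      by (auto intro!: derivative_eq_intros u' that simp: power2_eq_square)
    then have "w 0 \<le> w t"
      by (rule nonneg_derivative_imp_le[where a = 0]) (use a0 \<open>t \<ge> 0\<close> in auto)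
    moreover have "u 0 = 0" using init by (simp add: u_def)
    ultimately have "u t = 0" by (simp add: w_def)
    then show ?thesis by (simp add: u_def norm_eq_sqrt_inner)
  qed
  then show ?thesis by (simp add: sphere_prod_def)
qed

lemma frame_grad_inner_rgrad:
  assumes "X \<in> sphere_prod"
  shows "frame_grad X \<bullet> rgrad fobj X = (norm (rgrad fobj X))^2"
proof -
  have "frame_grad X $ i \<bullet> rgrad fobj X $ i = rgrad fobj X $ i \<bullet> rgrad fobj X $ i" for i
    using assms by (simp add: rgrad_fobj_nth inner_diff_left inner_diff_right inner_commute)
  then show ?thesis unfolding power2_norm_eq_inner inner_vec_def by simp
qed

lemma fobj_along_grad_flow:
  fixes \<Phi> :: "real \<Rightarrow> real^'d::finite^'n::finite"
  assumes sol: "grad_flow_solution fobj \<Phi>" and init: "\<Phi> 0 \<in> sphere_prod" and "t \<ge> 0"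
  shows "((\<lambda>t. fobj (\<Phi> t)) has_real_derivative (norm (rgrad fobj (\<Phi> t)))^2) (at t within {0..})"
proof -
  have "((\<lambda>t. fobj (\<Phi> t)) has_vector_derivative frame_grad (\<Phi> t) \<bullet> rgrad fobj (\<Phi> t)) (at t within {0..})"
    using vector_derivative_diff_chain_within[OF grad_flow_derivative[OF sol \<open>t \<ge> 0\<close>]
        has_derivative_at_withinI[OF fobj_has_derivative]]
    by (simp add: o_def)
  then show ?thesis
    using frame_grad_inner_rgrad[OF grad_flow_in_sphere_prod[OF assms]]
    by (simp add: has_real_derivative_iff_has_vector_derivative)
qed

lemma norm_le_columns:
  assumes "\<And>j. norm ((X :: real^'d^'n) $ j) \<le> b"
  shows "norm X \<le> real CARD('n) * b"
proof -
  have "norm X \<le> (\<Sum>j\<in>UNIV. norm (X$j))"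
    unfolding norm_vec_def[of X] by (rule L2_set_le_sum) simp
  also have "\<dots> \<le> (\<Sum>j\<in>(UNIV::'n set). b)" using assms by (intro sum_mono)
  finally show ?thesis by simp
qed

lemma sphere_prod_subset_cball: "(sphere_prod :: (real^'d^'n) set) \<subseteq> cball 0 (real CARD('n))"
proof
  fix X :: "real^'d^'n" assume "X \<in> sphere_prod"
  then show "X \<in> cball 0 (real CARD('n))"
    using norm_le_columns[of X 1] by (simp add: sphere_prodD)
qed

lemma compact_sphere_prod: "compact (sphere_prod :: (real^'d::finite^'n::finite) set)"
proof -
  have "bounded (sphere_prod :: (real^'d^'n) set)"
    using bounded_subset[OF bounded_cball sphere_prod_subset_cball] .
  moreover have "closed (sphere_prod :: (real^'d^'n) set)"
    unfolding sphere_prod_def by (intro closed_Collect_all closed_Collect_eq continuous_intros)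
  ultimately show ?thesis by (simp add: compact_eq_bounded_closed)
qed

text \<open>\<open>fobj\<close> increases along the solution and is bounded, so its increments over
  [k, k+1] tend to 0. The mean value theorem turns each into a squared gradient norm at some time
  \<open>\<sigma> k\<close>, and compactness gives the limit point.\<close>

lemma grad_flow_critical_limit_point:
  fixes \<Phi> :: "real \<Rightarrow> real^'d::finite^'n::finite"
  assumes sol: "grad_flow_solution fobj \<Phi>" and init: "\<Phi> 0 \<in> sphere_prod"
  obtains p \<tau> where "p \<in> sphere_prod" "rgrad fobj p = 0" "(\<lambda>k. \<Phi> (\<tau> k)) \<longlonglongrightarrow> p"
    "filterlim \<tau> at_top sequentially"
proof -
  define f where "f t = fobj (\<Phi> t)" for t
  have f': "(f has_real_derivative (norm (rgrad fobj (\<Phi> t)))^2) (at t within {0..})" if "t \<ge> 0" for t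
    unfolding f_def[abs_def] using fobj_along_grad_flow[OF sol init that] .
  have f_mono: "f s \<le> f t" if "0 \<le> s" "s \<le> t" for s t
    by (rule nonneg_derivative_imp_le[OF f', where a = 0]) (use that in auto)
  have f_le: "f t \<le> (real CARD('n))^2 / 4" if "t \<ge> 0" for t
    unfolding f_def by (intro fobj_le grad_flow_in_sphere_prod[OF sol init that])
  have "\<exists>s. real k \<le> s \<and> f (real (Suc k)) - f (real k) = (norm (rgrad fobj (\<Phi> s)))^2" for k
  proof -
    have "(f has_derivative (*) ((norm (rgrad fobj (\<Phi> x)))^2)) (at x within {real k..real (Suc k)})"
      if "real k \<le> x" for x
      using f'[of x] that
        has_derivative_subset[of f "(*) ((norm (rgrad fobj (\<Phi> x)))^2)" x "{0..}" "{real k..real (Suc k)}"]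
      by (auto simp: has_field_derivative_def)
    then obtain x where "x \<in> {real k<..<real (Suc k)}"
        "f (real (Suc k)) - f (real k) = (norm (rgrad fobj (\<Phi> x)))^2 * (real (Suc k) - real k)"
      using mvt_simple[of "real k" "real (Suc k)" f "\<lambda>x. (*) ((norm (rgrad fobj (\<Phi> x)))^2)"] by auto
    then show ?thesis by (intro exI[of _ x]) auto
  qed
  then obtain \<sigma> where \<sigma>: "\<And>k. real k \<le> \<sigma> k"
      "\<And>k. f (real (Suc k)) - f (real k) = (norm (rgrad fobj (\<Phi> (\<sigma> k))))^2" by metis
  have "incseq (\<lambda>k. f (real k))" by (intro incseq_SucI f_mono) auto
  then obtain L where L: "(\<lambda>k. f (real k)) \<longlonglongrightarrow> L"
    using incseq_convergent[of "\<lambda>k. f (real k)"] f_le by (metis of_nat_0_le_iff)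
  have "(\<lambda>k. f (real (Suc k)) - f (real k)) \<longlonglongrightarrow> L - L"
    by (intro tendsto_diff L LIMSEQ_Suc[OF L])
  then have "(\<lambda>k. sqrt ((norm (rgrad fobj (\<Phi> (\<sigma> k))))^2)) \<longlonglongrightarrow> sqrt 0"
    unfolding \<sigma>(2) by (intro tendsto_real_sqrt) simp
  then have grad0: "(\<lambda>k. rgrad fobj (\<Phi> (\<sigma> k))) \<longlonglongrightarrow> 0" by (simp add: tendsto_norm_zero_iff)
  have "\<Phi> (\<sigma> k) \<in> sphere_prod" for k
    using \<sigma>(1)[of k] by (intro grad_flow_in_sphere_prod[OF sol init]) linarith
  then obtain p r where p: "p \<in> sphere_prod" "strict_mono r" "((\<lambda>k. \<Phi> (\<sigma> k)) \<circ> r) \<longlonglongrightarrow> p"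
    using compact_sphere_prod unfolding compact_def by metis
  have lim: "(\<lambda>k. \<Phi> (\<sigma> (r k))) \<longlonglongrightarrow> p" using p(3) by (simp add: o_def)
  have "(\<lambda>k. rgrad fobj (\<Phi> (\<sigma> (r k)))) \<longlonglongrightarrow> rgrad fobj p"
    using continuous_on_tendsto_compose[OF continuous_on_rgrad_fobj[of UNIV] lim] by simp
  moreover have "(\<lambda>k. rgrad fobj (\<Phi> (\<sigma> (r k)))) \<longlonglongrightarrow> 0"
    using LIMSEQ_subseq_LIMSEQ[OF grad0 p(2)] by (simp add: o_def)
  ultimately have crit: "rgrad fobj p = 0" by (rule LIMSEQ_unique)
  have "filterlim \<sigma> at_top sequentially"
    by (rule filterlim_at_top_mono[OF filterlim_real_sequentially]) (simp add: \<sigma>(1))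
  then have "filterlim (\<lambda>k. \<sigma> (r k)) at_top sequentially"
    using filterlim_compose filterlim_subseq[OF p(2)] by blast
  then show ?thesis using that[of p "\<lambda>k. \<sigma> (r k)"] p(1) crit lim by blast
qed

text \<open>The inequality $f(p) - f \le K |\mathrm{grad} f|^2$ bounds the length of the trajectory by
  $2\sqrt{K (f(p) - f)}$, so the trajectory cannot leave a neighbourhood of its limit point.\<close>
lemma grad_flow_converges_to_critical:
  fixes \<Phi> :: "real \<Rightarrow> real^'d::finite^'n::finite"
  assumes sol: "grad_flow_solution fobj \<Phi>" and init: "\<Phi> 0 \<in> sphere_prod"
  obtains p where "p \<in> sphere_prod" "rgrad fobj p = 0" "(\<Phi> \<longlongrightarrow> p) at_top"
proof -
  obtain p \<tau> where p: "p \<in> sphere_prod" "rgrad fobj p = 0" and lim: "(\<lambda>k. \<Phi> (\<tau> k)) \<longlonglongrightarrow> p"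
    and \<tau>: "filterlim \<tau> at_top sequentially"
    using grad_flow_critical_limit_point[OF sol init] .
  obtain K r where K: "K > 0" "r > 0"
    and ineq: "\<And>X. X \<in> sphere_prod \<Longrightarrow> dist X p < r \<Longrightarrow> fobj p - fobj X \<le> K * (norm (rgrad fobj X))^2"
    using gradient_inequality_at_critical[OF p] by blast
  define h where "h t = fobj p - fobj (\<Phi> t)" for t
  have h': "(h has_real_derivative - ((norm (rgrad fobj (\<Phi> t)))^2)) (at t within {0..})" if "t \<ge> 0" for t
    unfolding h_def[abs_def]
    by (auto intro!: derivative_eq_intros fobj_along_grad_flow[OF sol init that])
  have at: "at t within {0..} = at t" if "t > 0" for t :: real
    by (rule at_within_interior) (use that in auto)
  have h_anti: "h t \<le> h s" if "0 \<le> s" "s \<le> t" for s t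
  proof -
    have "- h s \<le> - h t"
      by (rule nonneg_derivative_imp_le[where a = 0 and g = "\<lambda>t. - h t" and g' = "\<lambda>t. (norm (rgrad fobj (\<Phi> t)))^2"])
         (use that in \<open>auto intro!: derivative_eq_intros h'\<close>)
    then show ?thesis by simp
  qed
  have hlim: "(\<lambda>k. h (\<tau> k)) \<longlonglongrightarrow> 0"
  proof -
    have "continuous_on UNIV (fobj :: real^'d^'n \<Rightarrow> real)"
      using fobj_has_derivative has_derivative_continuous by (metis continuous_at_imp_continuous_on)
    then have "(\<lambda>k. fobj (\<Phi> (\<tau> k))) \<longlonglongrightarrow> fobj p"
      using continuous_on_tendsto_compose[OF _ lim, of UNIV fobj] by auto
    then have "(\<lambda>k. h (\<tau> k)) \<longlonglongrightarrow> fobj p - fobj p"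
      unfolding h_def by (intro tendsto_intros)
    then show ?thesis by simp
  qed
  have h_ge: "h t \<ge> 0" if "t \<ge> 0" for t
  proof (rule tendsto_upperbound[OF hlim])
    have "\<forall>\<^sub>F k in sequentially. \<tau> k \<ge> t" using \<tau> by (simp add: filterlim_at_top)
    then show "\<forall>\<^sub>F k in sequentially. h (\<tau> k) \<le> h t"
      by eventually_elim (use h_anti that in auto)
  qed simp
  have cont: "continuous_on {s..t} \<Phi>" if "0 \<le> s" for s t
  proof -
    have "continuous_on {0..} \<Phi>"
      using grad_flow_derivative[OF sol] has_vector_derivative_continuous
      by (metis atLeast_iff continuous_on_eq_continuous_within)
    then show ?thesis by (rule continuous_on_subset) (use that in auto)
  qed
  have conth: "continuous_on {s..t} h" if "0 \<le> s" for s t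
  proof -
    have "continuous_on {0..} h"
      using h' DERIV_continuous by (metis atLeast_iff continuous_on_eq_continuous_within)
    then show ?thesis by (rule continuous_on_subset) (use that in auto)
  qed
  \<comment> \<open>The derivative of -2 sqrt (K h) is sqrt K |grad|^2 / sqrt h, which dominates the
    speed |grad| because h <= K |grad|^2. Closeness is asked on the open interval only, so the bound
    reaches up to a first exit time.\<close>
  have length: "dist (\<Phi> t) (\<Phi> s) \<le> 2 * sqrt K * sqrt (h s)"
    if s: "0 \<le> s" "s \<le> t" and near: "\<And>x. s < x \<Longrightarrow> x < t \<Longrightarrow> dist (\<Phi> x) p < r"
      and pos: "\<And>x. x \<ge> 0 \<Longrightarrow> h x > 0" for s t
  proof (cases "s = t")
    case False
    then have st: "s < t" using s by simp
    have "norm (\<Phi> t - \<Phi> s) \<le> (- 2 * sqrt K * sqrt (h t)) - (- 2 * sqrt K * sqrt (h s))"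
    proof (rule differentiable_bound_general[OF st, where
          f' = "\<lambda>x. rgrad fobj (\<Phi> x)" and \<phi>' = "\<lambda>x. sqrt K * (norm (rgrad fobj (\<Phi> x)))^2 / sqrt (h x)"])
      show "continuous_on {s..t} \<Phi>" using cont s by blast
      show "continuous_on {s..t} (\<lambda>x. - 2 * sqrt K * sqrt (h x))"
        using conth[OF s(1)] by (intro continuous_intros)
      fix x assume x: "s < x" "x < t"
      then have x0: "x > 0" using s by simp
      show "(\<Phi> has_vector_derivative rgrad fobj (\<Phi> x)) (at x)"
        using grad_flow_derivative[OF sol, of x] x0 by (simp add: at)
      have "(h has_real_derivative - ((norm (rgrad fobj (\<Phi> x)))^2)) (at x)"
        using h'[of x] x0 by (simp add: at)
      moreover have hx: "h x > 0" using pos x0 by simp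
      moreover have coeff: "- 2 * c * (inverse a / 2 * - b) = c * b / a" for a b c :: real
        by (simp add: field_simps)
      ultimately have deriv: "((\<lambda>x. - 2 * sqrt K * sqrt (h x)) has_real_derivative
            - 2 * sqrt K * (inverse (sqrt (h x)) / 2 * - ((norm (rgrad fobj (\<Phi> x)))^2))) (at x)"
        by (intro DERIV_cmult DERIV_chain2[OF DERIV_real_sqrt])
      show "((\<lambda>x. - 2 * sqrt K * sqrt (h x)) has_vector_derivative
            sqrt K * (norm (rgrad fobj (\<Phi> x)))^2 / sqrt (h x)) (at x)"
        using deriv unfolding has_real_derivative_iff_has_vector_derivative coeff .
      have "h x \<le> K * (norm (rgrad fobj (\<Phi> x)))^2"
        unfolding h_def using x x0
        by (intro ineq near grad_flow_in_sphere_prod[OF sol init]) auto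
      then have "sqrt (h x) \<le> sqrt (K * (norm (rgrad fobj (\<Phi> x)))^2)" by (rule real_sqrt_le_mono)
      then have "sqrt (h x) \<le> sqrt K * norm (rgrad fobj (\<Phi> x))" by (simp add: real_sqrt_mult)
      then have "sqrt (h x) * norm (rgrad fobj (\<Phi> x)) \<le> (sqrt K * norm (rgrad fobj (\<Phi> x))) * norm (rgrad fobj (\<Phi> x))"
        by (intro mult_right_mono) auto
      then show "norm (rgrad fobj (\<Phi> x)) \<le> sqrt K * (norm (rgrad fobj (\<Phi> x)))^2 / sqrt (h x)"
        using hx by (simp add: field_simps power2_eq_square)
    qed
    moreover have "sqrt K * sqrt (h t) \<ge> 0" using K h_ge s by simp
    ultimately show ?thesis by (simp add: dist_norm)
  qed (use K pos s in \<open>auto simp: less_imp_le\<close>)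
  have "(\<Phi> \<longlongrightarrow> p) at_top"
  \<comment> \<open>The square root of h is differentiable only where h > 0. If h reaches 0 it stays
    0, and the solution is stationary from then on.\<close>
  proof (cases "\<exists>t1\<ge>0. h t1 = 0")
    case True
    then obtain t1 where t1: "t1 \<ge> 0" "h t1 = 0" by blast
    have h0: "h t = 0" if "t \<ge> t1" for t using h_anti[OF t1(1) that] h_ge[of t] t1 that by simp
    have stat: "rgrad fobj (\<Phi> t) = 0" if "t > t1" for t
    proof -
      have "((\<lambda>s. - h s) has_real_derivative (norm (rgrad fobj (\<Phi> t)))^2) (at t)"
        using h'[of t] that t1 by (auto intro!: derivative_eq_intros simp: at)
      then have "(norm (rgrad fobj (\<Phi> t)))^2 = 0"
        by (rule DERIV_local_max[where d = t]) (use h_ge h0[of t] that t1 in auto)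
      then show ?thesis by simp
    qed
    have const: "\<Phi> t = \<Phi> t1" if "t > t1" for t
    proof -
      have "norm (\<Phi> t - \<Phi> t1) \<le> (0::real) - 0"
      proof (rule differentiable_bound_general[OF that, where
          f' = "\<lambda>x. rgrad fobj (\<Phi> x)" and \<phi>' = "\<lambda>x. 0"])
        fix x assume "t1 < x" "x < t"
        then show "(\<Phi> has_vector_derivative rgrad fobj (\<Phi> x)) (at x)"
          using grad_flow_derivative[OF sol, of x] t1 by (simp add: at)
      qed (use cont t1 stat in auto)
      then show ?thesis by simp
    qed
    have ev: "\<forall>\<^sub>F t in at_top. \<Phi> t = \<Phi> t1"
      using eventually_gt_at_top[of t1] by eventually_elim (rule const)
    then have "(\<Phi> \<longlongrightarrow> \<Phi> t1) at_top" by (rule tendsto_eventually)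
    moreover have "(\<lambda>k. \<Phi> (\<tau> k)) \<longlonglongrightarrow> \<Phi> t1" using calculation \<tau> by (rule filterlim_compose)
    then have "p = \<Phi> t1" using lim LIMSEQ_unique by blast
    ultimately show ?thesis by simp
  next
    case False
    then have pos: "h x > 0" if "x \<ge> 0" for x using h_ge that by (metis less_eq_real_def)
    have trap: "\<exists>T\<ge>0. \<forall>t\<ge>T. dist (\<Phi> t) p \<le> e" if e: "0 < e" "e < r" for e
    proof -
      have "(\<lambda>k. 2 * sqrt K * sqrt (h (\<tau> k))) \<longlonglongrightarrow> 2 * sqrt K * sqrt 0"
        by (intro tendsto_intros hlim)
      then have "\<forall>\<^sub>F k in sequentially. 2 * sqrt K * sqrt (h (\<tau> k)) < e / 2"
        using e by (intro order_tendstoD(2)) auto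
      moreover have "\<forall>\<^sub>F k in sequentially. dist (\<Phi> (\<tau> k)) p < e / 2"
        using lim e by (intro tendstoD) auto
      moreover have "\<forall>\<^sub>F k in sequentially. \<tau> k \<ge> 0" using \<tau> by (simp add: filterlim_at_top)
      ultimately have "\<forall>\<^sub>F k in sequentially. 2 * sqrt K * sqrt (h (\<tau> k)) < e / 2 \<and>
           dist (\<Phi> (\<tau> k)) p < e / 2 \<and> \<tau> k \<ge> 0" by eventually_elim simp
      then obtain k where k: "2 * sqrt K * sqrt (h (\<tau> k)) < e / 2" "dist (\<Phi> (\<tau> k)) p < e / 2" "\<tau> k \<ge> 0"
        unfolding eventually_sequentially by blast
      define T where "T = \<tau> k"
      have step: "dist (\<Phi> t) p < e" if "t \<ge> T" "\<And>x. T < x \<Longrightarrow> x < t \<Longrightarrow> dist (\<Phi> x) p < r" for t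
        using length[OF _ that pos] k dist_triangle[of "\<Phi> t" p "\<Phi> T"] by (simp add: T_def)
      have "dist (\<Phi> t) p < r" if "t \<ge> T" for t
      proof (rule ccontr)
        assume far: "\<not> dist (\<Phi> t) p < r"
        \<comment> \<open>The times up to t at which distance r has been reached. The infimum of
          this closed set is a first exit time, where \<open>step\<close> still gives a distance
          below e < r.\<close>
        define B where "B = {T..t} \<inter> (\<lambda>x. dist (\<Phi> x) p) -` {r..}"
        have "closed B"
          unfolding B_def using cont[of T t] k
          by (intro continuous_closed_preimage continuous_intros) (auto simp: T_def)
        moreover have "B \<noteq> {}" "bdd_below B" using far that by (auto simp: B_def)
        ultimately have inf: "Inf B \<in> B" by (intro closed_contains_Inf)
        have "dist (\<Phi> x) p < r" if "T < x" "x < Inf B" for x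
        proof (rule ccontr)
          assume "\<not> dist (\<Phi> x) p < r"
          then have "x \<in> B" using that inf by (auto simp: B_def)
          then show False using cInf_lower[OF _ \<open>bdd_below B\<close>] that by fastforce
        qed
        then have "dist (\<Phi> (Inf B)) p < e" using inf by (intro step) (auto simp: B_def)
        then show False using inf e by (auto simp: B_def)
      qed
      then have "\<forall>t\<ge>T. dist (\<Phi> t) p \<le> e" using step by (simp add: less_imp_le)
      then show ?thesis using k(3) T_def by blast
    qed
    show ?thesis
    proof (rule tendstoI)
      fix e :: real assume "e > 0"
      moreover have "min (e/2) (r/2) < r" using K(2) by (simp add: min_def)
      ultimately obtain T where "\<forall>t\<ge>T. dist (\<Phi> t) p \<le> min (e/2) (r/2)"
        using trap[of "min (e/2) (r/2)"] K(2) by auto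
      then have "dist (\<Phi> t) p < e" if "t \<ge> T" for t using that \<open>e > 0\<close> by (smt (verit) field_sum_of_halves)
      then show "\<forall>\<^sub>F t in at_top. dist (\<Phi> t) p < e"
        unfolding eventually_at_top_linorder by blast
    qed
  qed
  then show ?thesis using that p by blast
qed

section \<open>Instability of the non-maximal critical points\<close>

lemma C1_bounded_derivative:
  fixes f' :: "'a::euclidean_space \<Rightarrow> 'a \<Rightarrow> 'b::euclidean_space"
  assumes lin: "\<And>x. linear (f' x)" and cont: "continuous_on UNIV (\<lambda>(x, h). f' x h)"
  shows "\<exists>L>0. \<forall>x\<in>cball a R. \<forall>h. norm (f' x h) \<le> L * norm h"
proof -
  have "compact ((\<lambda>(x, h). f' x h) ` (cball a R \<times> cball 0 1))"
    by (intro compact_continuous_image compact_Times continuous_on_subset[OF cont]) auto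
  then obtain L where "L > 0" and bound: "\<forall>y\<in>(\<lambda>(x, h). f' x h) ` (cball a R \<times> cball 0 1). norm y \<le> L"
    using compact_imp_bounded bounded_pos by blast
  have L: "norm (f' x h) \<le> L" if "x \<in> cball a R" "norm h \<le> 1" for x h
    using that by (intro bspec[OF bound] image_eqI[of _ _ "(x, h)"]) auto
  have "norm (f' x h) \<le> L * norm h" if "x \<in> cball a R" for x h
  proof (cases "h = 0")
    case False
    have "norm (f' x (h /\<^sub>R norm h)) \<le> L" using that False by (intro L) auto
    then show ?thesis using False by (simp add: linear_scale[OF lin] field_simps)
  qed (simp add: linear_0[OF lin])
  then show ?thesis using \<open>L > 0\<close> by blast
qed

lemma C1_Lipschitz_on_cball:
  fixes f :: "'a::euclidean_space \<Rightarrow> 'b::euclidean_space"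
  assumes deriv: "\<And>x. (f has_derivative f' x) (at x)" and cont: "continuous_on UNIV (\<lambda>(x, h). f' x h)"
  shows "\<exists>L>0. \<forall>x\<in>cball a R. \<forall>y\<in>cball a R. norm (f y - f x) \<le> L * norm (y - x)"
proof -
  have lin: "linear (f' x)" for x using deriv has_derivative_linear by blast
  obtain L where L: "L > 0" "\<And>x h. x \<in> cball a R \<Longrightarrow> norm (f' x h) \<le> L * norm h"
    using C1_bounded_derivative[OF lin cont, of a R] by blast
  have "norm (f y - f x) \<le> L * norm (y - x)" if "x \<in> cball a R" "y \<in> cball a R" for x y
    by (rule differentiable_bound[OF convex_cball has_derivative_at_withinI[OF deriv] _ that(2,1)])
       (auto intro!: onorm_le L)
  then show ?thesis using L(1) by blast
qed

text \<open>Both points vary, as is needed for comparing two solutions. The mean value inequality is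
  applied to f minus its linearisation at a, whose derivative is uniformly small near a by
  compactness.\<close>

lemma C1_strictly_differentiable:
  fixes f :: "'a::euclidean_space \<Rightarrow> 'b::euclidean_space"
  assumes deriv: "\<And>x. (f has_derivative f' x) (at x)" and cont: "continuous_on UNIV (\<lambda>(x, h). f' x h)"
    and "e > 0"
  shows "\<exists>r>0. \<forall>x\<in>ball a r. \<forall>y\<in>ball a r. norm (f y - f x - f' a (y - x)) \<le> e * norm (y - x)"
proof -
  have lin: "linear (f' x)" for x using deriv has_derivative_linear by blast
  have "uniformly_continuous_on (cball a 1 \<times> cball 0 1) (\<lambda>(x, h). f' x h)"
    by (intro compact_uniformly_continuous compact_Times continuous_on_subset[OF cont]) auto
  then obtain d where d: "d > 0"
    "\<And>z z'. z \<in> cball a 1 \<times> cball 0 1 \<Longrightarrow> z' \<in> cball a 1 \<times> cball 0 1 \<Longrightarrow> dist z' z < d \<Longrightarrow>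
        dist ((\<lambda>(x, h). f' x h) z') ((\<lambda>(x, h). f' x h) z) < e"
    unfolding uniformly_continuous_on_def using \<open>e > 0\<close> by metis
  define r where "r = min d 1"
  have unit: "norm (f' x h - f' a h) \<le> e" if "x \<in> ball a r" "norm h \<le> 1" for x h
  proof -
    have "dist (f' x h) (f' a h) < e"
      using d(2)[of "(a, h)" "(x, h)"] that by (auto simp: r_def dist_Pair_Pair dist_commute)
    then show ?thesis by (simp add: dist_norm)
  qed
  have bnd: "norm (f' x h - f' a h) \<le> e * norm h" if "x \<in> ball a r" for x h
  proof (cases "h = 0")
    case False
    have "norm (f' x (h /\<^sub>R norm h) - f' a (h /\<^sub>R norm h)) \<le> e" using that False by (intro unit) auto
    then have "norm ((f' x h - f' a h) /\<^sub>R norm h) \<le> e"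
      by (simp only: linear_scale[OF lin] scaleR_diff_right)
    then have "inverse (norm h) * norm (f' x h - f' a h) \<le> e"
      by (simp only: norm_scaleR abs_inverse abs_norm_cancel)
    then show ?thesis using False by (simp add: field_simps)
  qed (simp add: linear_0[OF lin])
  have "norm (f y - f x - f' a (y - x)) \<le> e * norm (y - x)" if "x \<in> ball a r" "y \<in> ball a r" for x y
  proof -
    have "norm ((f y - f' a y) - (f x - f' a x)) \<le> e * norm (y - x)"
    proof (rule differentiable_bound[OF convex_ball _ _ that(2,1)])
      fix z assume z: "z \<in> ball a r"
      show "((\<lambda>y. f y - f' a y) has_derivative (\<lambda>h. f' z h - f' a h)) (at z within ball a r)"
        by (intro has_derivative_diff has_derivative_at_withinI[OF deriv]
            bounded_linear_imp_has_derivative) (simp add: linear_conv_bounded_linear[symmetric] lin)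
      show "onorm (\<lambda>h. f' z h - f' a h) \<le> e" using z by (intro onorm_le bnd)
    qed
    then show ?thesis by (simp add: linear_diff[OF lin] algebra_simps)
  qed
  moreover have "r > 0" using d(1) by (simp add: r_def)
  ultimately show ?thesis by blast
qed

text \<open>Eigenvectors for distinct eigenvalues are orthogonal, so there are finitely many
  eigenvalues and the interval (0, a) contains a number that is none of them.\<close>

lemma symmetric_map_regular_shift:
  fixes H :: "'a::euclidean_space \<Rightarrow> 'a"
  assumes lin: "linear H" and sym: "\<And>x y. x \<bullet> H y = H x \<bullet> y" and "a > 0"
  obtains \<mu> g where "0 < \<mu>" "\<mu> < a" "g > 0" "\<And>x. g * norm x \<le> norm (H x - \<mu> *\<^sub>R x)"
proof -
  have "\<exists>\<mu>. 0 < \<mu> \<and> \<mu> < a \<and> (\<forall>x. H x = \<mu> *\<^sub>R x \<longrightarrow> x = 0)"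
  proof (rule ccontr)
    assume "\<not> ?thesis"
    then have "\<forall>\<mu>\<in>{0<..<a}. \<exists>x. H x = \<mu> *\<^sub>R x \<and> x \<noteq> 0" by auto
    then obtain e where e: "\<And>\<mu>. \<mu> \<in> {0<..<a} \<Longrightarrow> H (e \<mu>) = \<mu> *\<^sub>R e \<mu> \<and> e \<mu> \<noteq> 0" by metis
    have orth: "e \<mu> \<bullet> e \<nu> = 0" if "\<mu> \<in> {0<..<a}" "\<nu> \<in> {0<..<a}" "\<mu> \<noteq> \<nu>" for \<mu> \<nu>
    proof -
      have "\<nu> * (e \<mu> \<bullet> e \<nu>) = \<mu> * (e \<mu> \<bullet> e \<nu>)" using sym[of "e \<mu>" "e \<nu>"] e that by simp
      then show ?thesis using that by simp
    qed
    have "pairwise orthogonal (e ` {0<..<a})"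
      unfolding pairwise_def orthogonal_def by (auto intro!: orth)
    then have "finite (e ` {0<..<a})" by (rule pairwise_orthogonal_imp_finite)
    moreover have "inj_on e {0<..<a}"
      using orth e by (metis inj_onI inner_eq_zero_iff)
    ultimately have "finite {0<..<a}" using finite_imageD by blast
    then show False using \<open>a > 0\<close> infinite_Ioo by blast
  qed
  then obtain \<mu> where \<mu>: "0 < \<mu>" "\<mu> < a" "\<And>x. H x = \<mu> *\<^sub>R x \<Longrightarrow> x = 0" by blast
  have lin': "linear (\<lambda>x. H x - \<mu> *\<^sub>R x)"
    by (intro linear_compose_sub lin linear_scale_self)
  have "inj (\<lambda>x. H x - \<mu> *\<^sub>R x)"
    unfolding linear_injective_0[OF lin'] using \<mu>(3) by simp
  then obtain g where "g > 0" "\<And>x. g * norm x \<le> norm (H x - \<mu> *\<^sub>R x)"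
    using linear_inj_bounded_below_pos[OF lin'] by blast
  then show ?thesis using that \<mu> by blast
qed

section \<open>The Hessian at a critical point\<close>

lemma columns_eq_iff: "(X :: real^'d^'n) = Y \<longleftrightarrow> (\<forall>i. X$i = Y$i)"
  by (rule vec_eq_iff)

lemma inner_columns: "(X :: real^'d^'n) \<bullet> Y = (\<Sum>i\<in>UNIV. X$i \<bullet> Y$i)"
  by (rule inner_vec_def)

lemma proj_tangent_nth: "proj_tangent X Z $ i = Z$i - (X$i \<bullet> Z$i) *\<^sub>R X$i"
  by (simp add: proj_tangent_def)

lemma linear_proj_tangent: "linear (proj_tangent X)"
  by (rule linearI) (simp_all add: columns_eq_iff proj_tangent_nth inner_add_right algebra_simps)

lemma proj_tangent_adjoint: "W \<bullet> proj_tangent X Z = proj_tangent X W \<bullet> Z"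
  unfolding inner_columns
  by (intro sum.cong) (auto simp: proj_tangent_nth inner_diff_left inner_diff_right inner_commute)

lemma proj_tangent_perp: "X \<in> sphere_prod \<Longrightarrow> X$i \<bullet> proj_tangent X Z $ i = 0"
  by (simp add: proj_tangent_nth inner_diff_right)

lemma proj_tangent_fixed: "(\<And>i. X$i \<bullet> Z$i = 0) \<Longrightarrow> proj_tangent X Z = Z"
  by (simp add: columns_eq_iff proj_tangent_nth)

lemma linear_frame_hess: "linear (frame_hess X)"
  by (intro linearI)
     (simp_all add: frame_hess_def columns_eq_iff inner_add_left inner_add_right
       scaleR_add_left scaleR_add_right sum.distrib scaleR_sum_right algebra_simps)

text \<open>Symmetry of second derivatives, checked directly by exchanging the two indices in the
  double sums.\<close>

lemma frame_hess_adjoint: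
  fixes X :: "real^'d::finite^'n::finite"
  shows "K \<bullet> frame_hess X H = frame_hess X K \<bullet> H"
proof -
  define Q where "Q K H = (\<Sum>i\<in>UNIV. \<Sum>j\<in>UNIV. (X$j \<bullet> H$i) * (K$i \<bullet> X$j) + (H$j \<bullet> X$i) * (K$i \<bullet> X$j)
       + (X$j \<bullet> X$i) * (K$i \<bullet> H$j))" for H K
  have Q: "K \<bullet> frame_hess X H = Q K H" for K H
    unfolding inner_columns frame_hess_def Q_def
    by (simp add: inner_sum_right inner_add_right algebra_simps)
  have "(\<Sum>i\<in>UNIV. \<Sum>j\<in>UNIV. (H$j \<bullet> X$i) * (K$i \<bullet> X$j)) = (\<Sum>i\<in>UNIV. \<Sum>j\<in>UNIV. (K$j \<bullet> X$i) * (H$i \<bullet> X$j))"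
    by (subst sum.swap) (simp add: mult.commute)
  moreover have "(\<Sum>i\<in>UNIV. \<Sum>j\<in>UNIV. (X$j \<bullet> X$i) * (K$i \<bullet> H$j)) = (\<Sum>i\<in>UNIV. \<Sum>j\<in>UNIV. (X$j \<bullet> X$i) * (H$i \<bullet> K$j))"
    by (subst sum.swap) (simp add: inner_commute)
  moreover have "(\<Sum>i\<in>UNIV. \<Sum>j\<in>UNIV. (X$j \<bullet> H$i) * (K$i \<bullet> X$j)) = (\<Sum>i\<in>UNIV. \<Sum>j\<in>UNIV. (X$j \<bullet> K$i) * (H$i \<bullet> X$j))"
    by (simp add: inner_commute mult.commute)
  ultimately have "Q K H = Q H K" by (simp add: Q_def sum.distrib)
  then show ?thesis by (metis Q inner_commute)
qed

text \<open>At a critical point the Riemannian Hessian, extended by zero to the normal space.\<close>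
definition crit_hess :: "real^'d^'n \<Rightarrow> real^'d^'n \<Rightarrow> real^'d^'n" where
  "crit_hess P H = proj_tangent P (\<chi> i. frame_hess P (proj_tangent P H) $ i
       - (P$i \<bullet> frame_op P (P$i)) *\<^sub>R proj_tangent P H $ i)"

lemma linear_column_scale: "linear (\<lambda>Z::real^'d^'n. \<chi> i. l i *\<^sub>R Z$i)"
  by (rule linearI) (simp_all add: columns_eq_iff scaleR_add_right)

lemma crit_hess_alt:
  "crit_hess P H = proj_tangent P (frame_hess P (proj_tangent P H)
       - (\<chi> i. (P$i \<bullet> frame_op P (P$i)) *\<^sub>R proj_tangent P H $ i))"
  unfolding crit_hess_def by (rule arg_cong[of _ _ "proj_tangent P"]) (simp add: vec_eq_iff)

lemma linear_crit_hess: "linear (crit_hess P)"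
proof -
  have "crit_hess P = proj_tangent P \<circ> (\<lambda>Z. frame_hess P Z - (\<chi> i. (P$i \<bullet> frame_op P (P$i)) *\<^sub>R Z$i)) \<circ> proj_tangent P"
    by (simp add: fun_eq_iff crit_hess_alt)
  then show ?thesis
    by (simp only:) (intro linear_compose linear_proj_tangent linear_compose_sub linear_frame_hess linear_column_scale)
qed

lemma crit_hess_adjoint:
  fixes P :: "real^'d::finite^'n::finite"
  shows "K \<bullet> crit_hess P H = crit_hess P K \<bullet> H"
proof -
  have "(proj_tangent P K) \<bullet> (\<chi> i. (P$i \<bullet> frame_op P (P$i)) *\<^sub>R proj_tangent P H $ i)
      = (\<chi> i. (P$i \<bullet> frame_op P (P$i)) *\<^sub>R proj_tangent P K $ i) \<bullet> proj_tangent P H"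
    by (simp add: inner_columns)
  then show ?thesis
    unfolding crit_hess_alt proj_tangent_adjoint[of K] proj_tangent_adjoint[symmetric, of _ _ H]
    by (simp add: inner_diff_left inner_diff_right frame_hess_adjoint)
qed

text \<open>Criticality makes each \<open>frame_op P (P$i)\<close> a multiple of \<open>P$i\<close>,
  which removes the term \<open>H$i \<bullet> frame_op P (P$i)\<close> for tangent H.\<close>

lemma rgrad_deriv_tangent:
  assumes P: "P \<in> sphere_prod" and crit: "rgrad fobj P = 0" and tan: "\<And>i. P$i \<bullet> H$i = 0"
  shows "rgrad_deriv P H = crit_hess P H"
proof -
  have eig: "frame_op P (P$i) = (P$i \<bullet> frame_op P (P$i)) *\<^sub>R P$i" for i
    using crit by (simp add: rgrad_fobj_eq_0_iff)
  have "H$i \<bullet> frame_op P (P$i) = 0" for i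
    by (subst eig) (simp add: tan inner_commute[of "H$i"])
  then show ?thesis
    by (simp add: columns_eq_iff crit_hess_def rgrad_deriv_def proj_tangent_nth
        proj_tangent_fixed[OF tan] inner_diff_right tan algebra_simps)
qed

text \<open>The same value as in \<open>rhess_fobj_single_column\<close>; here the
  \<open>+ 1\<close> is the term with j = i in \<open>frame_hess\<close>, where (p_i.p_i) u =
  u.\<close>

lemma crit_hess_single_column:
  fixes P :: "real^'d::finite^'n::finite"
  assumes P: "P \<in> sphere_prod" and u: "norm u = 1" "P$i \<bullet> u = 0"
  defines "V \<equiv> (\<chi> k. if k = i then u else 0)"
  shows "V \<bullet> crit_hess P V = u \<bullet> frame_op P u - P$i \<bullet> frame_op P (P$i) + 1"
proof -
  have tan: "P$k \<bullet> V$k = 0" for k using u by (simp add: V_def)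
  have single: "V \<bullet> Z = u \<bullet> Z$i" for Z :: "real^'d^'n"
  proof -
    have "V \<bullet> Z = (\<Sum>k\<in>UNIV. if k = i then u \<bullet> Z$k else 0)"
      unfolding inner_columns by (intro sum.cong) (auto simp: V_def)
    then show ?thesis by simp
  qed
  have Vi: "V$i = u" and uP: "u \<bullet> P$i = 0" using u by (simp_all add: V_def inner_commute)
  have "frame_hess P V $ i = frame_op P u + u"
  proof -
    have "V$j \<bullet> P$i = 0" for j using u by (auto simp: V_def inner_commute)
    then have "frame_hess P V $ i = frame_op P u + (\<Sum>j\<in>UNIV. (P$j \<bullet> P$i) *\<^sub>R V$j)"
      by (simp add: frame_hess_def frame_op_def sum.distrib V_def)
    also have "(\<Sum>j\<in>UNIV. (P$j \<bullet> P$i) *\<^sub>R V$j) = (\<Sum>j\<in>UNIV. if j = i then u else 0)"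
      using P by (intro sum.cong) (auto simp: V_def)
    finally show ?thesis by simp
  qed
  moreover have "u \<bullet> u = 1" using u by (simp add: dot_square_norm)
  ultimately show ?thesis
    unfolding crit_hess_def single proj_tangent_nth proj_tangent_fixed[OF tan]
    by (simp add: Vi uP inner_diff_right inner_add_right)
qed

lemma continuous_on_rgrad_deriv:
  "continuous_on A (\<lambda>(X::real^'d::finite^'n::finite, H). rgrad_deriv X H)"
  unfolding rgrad_deriv_def frame_hess_def frame_op_def case_prod_beta
  by (intro continuous_on_vec_lambda) (auto intro!: continuous_intros)

text \<open>Strict differentiability gives the estimate with \<open>rgrad_deriv P\<close>, which is
  identified with \<open>crit_hess P\<close> on tangent vectors. Y - X need not be tangent at P, but
  its normal part is smaller by a factor r: x_i + y_i is orthogonal to y_i - x_i, and the midpoint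
  lies within r of p_i.\<close>

lemma rgrad_fobj_difference_near_critical:
  fixes P :: "real^'d::finite^'n::finite"
  assumes P: "P \<in> sphere_prod" and crit: "rgrad fobj P = 0" and "g > 0"
  shows "\<exists>r>0. \<forall>X\<in>sphere_prod. \<forall>Y\<in>sphere_prod. dist X P < r \<longrightarrow> dist Y P < r \<longrightarrow>
     norm (rgrad fobj Y - rgrad fobj X - crit_hess P (Y - X)) \<le> g * norm (Y - X)"
proof -
  have lin: "linear (rgrad_deriv P)"
    using rgrad_fobj_has_derivative has_derivative_linear by blast
  obtain C where C: "C > 0" "\<And>H. norm (rgrad_deriv P H) \<le> C * norm H"
    using linear_bounded_pos[OF lin] by blast
  obtain r0 where r0: "r0 > 0" "\<And>X Y. X \<in> ball P r0 \<Longrightarrow> Y \<in> ball P r0 \<Longrightarrow>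
      norm (rgrad fobj Y - rgrad fobj X - rgrad_deriv P (Y - X)) \<le> (g/2) * norm (Y - X)"
    using C1_strictly_differentiable[OF rgrad_fobj_has_derivative continuous_on_rgrad_deriv, of "g/2" P] \<open>g > 0\<close>
    by (auto simp: case_prod_beta)
  \<comment> \<open>One half of g pays for the nonlinear remainder, the other half for the normal
    part.\<close>
  define r where "r = min r0 (g / (2 * C))"
  have r: "r > 0" "r \<le> r0" "C * r \<le> g / 2"
    using r0 C \<open>g > 0\<close> by (auto simp: r_def min_def field_simps)
  have "norm (rgrad fobj Y - rgrad fobj X - crit_hess P (Y - X)) \<le> g * norm (Y - X)"
    if X: "X \<in> sphere_prod" "dist X P < r" and Y: "Y \<in> sphere_prod" "dist Y P < r" for X Y
  proof -
    define D where "D = Y - X"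
    define N where "N = D - proj_tangent P D"
    have N: "norm (N $ i) \<le> r * norm (D $ i)" for i
    proof -
      have "norm (X$i - P$i) \<le> r" "norm (Y$i - P$i) \<le> r"
        using X(2) Y(2) Finite_Cartesian_Product.norm_nth_le[of "X - P" i] Finite_Cartesian_Product.norm_nth_le[of "Y - P" i] by (auto simp: dist_norm)
      then have "norm ((1/2) *\<^sub>R ((X$i - P$i) + (Y$i - P$i))) \<le> r"
        using norm_triangle_ineq[of "X$i - P$i" "Y$i - P$i"] by simp
      moreover have "(X$i + Y$i) \<bullet> D$i = 0"
        using X(1) Y(1) by (simp add: D_def inner_diff_right inner_add_left inner_commute[of "X$i" "Y$i"])
      then have "P$i \<bullet> D$i = - (((1/2) *\<^sub>R ((X$i - P$i) + (Y$i - P$i))) \<bullet> D$i)"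
        unfolding inner_scaleR_left inner_add_left inner_diff_left by simp
      ultimately have "\<bar>P$i \<bullet> D$i\<bar> \<le> r * norm (D$i)"
        using Cauchy_Schwarz_ineq2[of "(1/2) *\<^sub>R ((X$i - P$i) + (Y$i - P$i))" "D$i"]
        by (smt (verit) mult_right_mono norm_ge_zero)
      then show ?thesis using sphere_prodD[OF P] by (simp add: N_def proj_tangent_nth)
    qed
    have "(norm N)^2 \<le> (\<Sum>i\<in>UNIV. (r * norm (D$i))^2)"
      unfolding norm_power2_columns[of N] using N by (intro sum_mono power_mono) auto
    also have "\<dots> = (r * norm D)^2"
      by (simp add: norm_power2_columns[of D] power_mult_distrib sum_distrib_left)
    finally have "norm N \<le> r * norm D" by (rule power2_le_imp_le) (use r in simp)
    then have "C * norm N \<le> C * r * norm D" using C(1) by simp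
    also have "\<dots> \<le> (g/2) * norm D" using r(3) by (intro mult_right_mono) auto
    finally have 1: "norm (rgrad_deriv P N) \<le> (g/2) * norm D" using C(2)[of N] by linarith
    have "crit_hess P D = crit_hess P (proj_tangent P D)"
      using proj_tangent_fixed[of P "proj_tangent P D"] proj_tangent_perp[OF P] by (simp add: crit_hess_def)
    also have "\<dots> = rgrad_deriv P (proj_tangent P D)"
      using rgrad_deriv_tangent[OF P crit] proj_tangent_perp[OF P] by simp
    also have "\<dots> = rgrad_deriv P D - rgrad_deriv P N"
      by (simp add: N_def linear_diff[OF lin])
    finally have split: "rgrad fobj Y - rgrad fobj X - crit_hess P D
        = (rgrad fobj Y - rgrad fobj X - rgrad_deriv P D) + rgrad_deriv P N" by simp
    have "norm (rgrad fobj Y - rgrad fobj X - rgrad_deriv P D) \<le> (g/2) * norm D"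
      unfolding D_def using X Y r by (intro r0(2)) (auto simp: dist_commute)
    then have "norm (rgrad fobj Y - rgrad fobj X - crit_hess P D) \<le> (g/2) * norm D + (g/2) * norm D"
      unfolding split using 1 by (intro norm_triangle_le add_mono)
    then show ?thesis by (simp add: D_def)
  qed
  then show ?thesis using r(1) by blast
qed

text \<open>With $\mu > 0$ not an eigenvalue of the Hessian $H$, the form $V(\delta) = \langle\delta,
  (H - \mu)\delta\rangle$ of the difference of two trajectories near $P$ satisfies $V' \ge 2\mu V$, because
  $\langle (H-\mu)\delta, H\delta\rangle = |(H-\mu)\delta|^2 + \mu V(\delta)$. So $V > 0$ forces the
  trajectories apart.\<close>
lemma unstable_form:
  fixes P :: "real^'d::finite^'n::finite"
  assumes P: "P \<in> sphere_prod" and crit: "rgrad fobj P = 0" and nmax: "\<not> global_max_on_M fobj P"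
  obtains i u B r where "norm u = 1" "P$i \<bullet> u = 0" "linear B"
    "(\<chi> k. if k = i then u else 0) \<bullet> B (\<chi> k. if k = i then u else 0) > 0" "r > 0"
    "\<And>\<Phi> \<Psi> T. grad_flow_solution fobj \<Phi> \<Longrightarrow> grad_flow_solution fobj \<Psi> \<Longrightarrow>
       \<Phi> 0 \<in> sphere_prod \<Longrightarrow> \<Psi> 0 \<in> sphere_prod \<Longrightarrow> T \<ge> 0 \<Longrightarrow>
       (\<And>t. t \<ge> T \<Longrightarrow> dist (\<Phi> t) P < r) \<Longrightarrow> (\<And>t. t \<ge> T \<Longrightarrow> dist (\<Psi> t) P < r) \<Longrightarrow>
       (\<Psi> T - \<Phi> T) \<bullet> B (\<Psi> T - \<Phi> T) \<le> 0"
proof -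
  obtain i u where u: "norm u = 1" "P$i \<bullet> u = 0" "u \<bullet> frame_op P u \<ge> P$i \<bullet> frame_op P (P$i)"
    using not_global_max_direction[OF P crit nmax] .
  define v :: "real^'d^'n" where "v = (\<chi> k. if k = i then u else 0)"
  have v: "v \<bullet> crit_hess P v \<ge> 1"
    unfolding v_def crit_hess_single_column[OF P u(1,2)] using u(3) by simp
  have vv: "v \<bullet> v = 1"
  proof -
    have "v \<bullet> v = (\<Sum>k\<in>UNIV. if k = i then u \<bullet> u else 0)"
      unfolding inner_columns by (intro sum.cong) (auto simp: v_def)
    then show ?thesis using u by (simp add: dot_square_norm)
  qed
  \<comment> \<open>\<open>\<mu> < 1\<close> keeps v.B v >= 1 - \<open>\<mu>\<close> positive, and
    \<open>\<mu> > 0\<close> gives exponential growth. The lower bound g also fixes the radius r, so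
    that the error term in \<open>growth\<close> is at most |B D|^2.\<close>
  obtain \<mu> g where \<mu>: "0 < \<mu>" "\<mu> < 1" and g: "g > 0" "\<And>x. g * norm x \<le> norm (crit_hess P x - \<mu> *\<^sub>R x)"
    using symmetric_map_regular_shift[OF linear_crit_hess crit_hess_adjoint zero_less_one] by blast
  define B where "B x = crit_hess P x - \<mu> *\<^sub>R x" for x
  have linB: "linear B"
    unfolding B_def by (intro linear_compose_sub linear_crit_hess linear_scale_self)
  have symB: "x \<bullet> B y = B x \<bullet> y" for x y
    by (simp add: B_def inner_diff_left inner_diff_right crit_hess_adjoint)
  obtain b where b: "b > 0" "\<And>x. norm (B x) \<le> b * norm x"
    using linear_bounded_pos[OF linB] by blast
  obtain r where r: "r > 0" "\<And>X Y. X \<in> sphere_prod \<Longrightarrow> Y \<in> sphere_prod \<Longrightarrow> dist X P < r \<Longrightarrow> dist Y P < r \<Longrightarrow>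
     norm (rgrad fobj Y - rgrad fobj X - crit_hess P (Y - X)) \<le> g * norm (Y - X)"
    using rgrad_fobj_difference_near_critical[OF P crit g(1)] by blast
  have main: "(\<Psi> T - \<Phi> T) \<bullet> B (\<Psi> T - \<Phi> T) \<le> 0"
    if sol: "grad_flow_solution fobj \<Phi>" "grad_flow_solution fobj \<Psi>"
      and init: "\<Phi> 0 \<in> sphere_prod" "\<Psi> 0 \<in> sphere_prod" and T: "T \<ge> 0"
      and near: "\<And>t. t \<ge> T \<Longrightarrow> dist (\<Phi> t) P < r" "\<And>t. t \<ge> T \<Longrightarrow> dist (\<Psi> t) P < r" for \<Phi> \<Psi> T
  proof (rule ccontr)
    define D where "D t = \<Psi> t - \<Phi> t" for t
    define D' where "D' t = rgrad fobj (\<Psi> t) - rgrad fobj (\<Phi> t)" for t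
    define V where "V t = D t \<bullet> B (D t)" for t
    assume "\<not> ?thesis"
    then have VT: "V T > 0" by (simp add: V_def D_def)
    have D: "(D has_vector_derivative D' t) (at t within {0..})" if "t \<ge> 0" for t
      unfolding D_def[abs_def] D'_def
      by (intro has_vector_derivative_diff grad_flow_derivative sol that)
    have V': "(V has_real_derivative 2 * (B (D t) \<bullet> D' t)) (at t within {0..})" if "t \<ge> 0" for t
    proof -
      have "((\<lambda>t. B (D t)) has_vector_derivative B (D' t)) (at t within {0..})"
        using bounded_linear.has_vector_derivative[OF _ D[OF that]] linB linear_conv_bounded_linear by blast
      from bounded_bilinear.has_vector_derivative[OF bounded_bilinear_inner D[OF that] this]
      show ?thesis unfolding V_def[abs_def] has_real_derivative_iff_has_vector_derivative
        using symB[of "D t" "D' t"] inner_commute[of "D' t" "B (D t)"] by simp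
    qed
    have growth: "B (D t) \<bullet> D' t \<ge> \<mu> * V t" if "t \<ge> T" for t
    proof -
      define E where "E = D' t - crit_hess P (D t)"
      have E: "norm E \<le> g * norm (D t)"
        unfolding E_def D'_def D_def using that T
        by (intro r(2) near grad_flow_in_sphere_prod[OF sol(1) init(1)] grad_flow_in_sphere_prod[OF sol(2) init(2)]) auto
      have "D' t = B (D t) + \<mu> *\<^sub>R D t + E" by (simp add: B_def E_def)
      then have "B (D t) \<bullet> D' t = (norm (B (D t)))^2 + \<mu> * V t + B (D t) \<bullet> E"
        by (simp add: inner_add_right power2_norm_eq_inner V_def inner_commute)
      moreover have "\<bar>B (D t) \<bullet> E\<bar> \<le> norm (B (D t)) * norm (B (D t))"
        using Cauchy_Schwarz_ineq2[of "B (D t)" E] E g(2)[of "D t"]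
        by (smt (verit) B_def mult_left_mono norm_ge_zero)
      ultimately show ?thesis by (simp add: power2_eq_square)
    qed
    define W where "W t = exp (- 2 * \<mu> * t) * V t" for t
    have W': "(W has_real_derivative exp (- 2 * \<mu> * t) * (2 * (B (D t) \<bullet> D' t - \<mu> * V t))) (at t within {0..})"
      if "t \<ge> 0" for t
      unfolding W_def[abs_def]
      by (auto intro!: derivative_eq_intros V' that simp: algebra_simps)
    \<comment> \<open>\<open>R\<close> bounds V while both solutions stay within r of P. The time t
      is such that 1 + x <= exp x already forces V to reach V T + R.\<close>
    define R where "R = b * (2 * r)^2"
    define t where "t = T + R / (2 * \<mu> * V T)"
    have R0: "R \<ge> 0" using b by (simp add: R_def)
    have t: "t \<ge> T" using R0 VT \<mu> by (simp add: t_def)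
    have "W T \<le> W t"
      by (rule nonneg_derivative_imp_le[OF W', where a = T]) (use growth T t in auto)
    then have "exp (2 * \<mu> * t) * W T \<le> exp (2 * \<mu> * t) * W t" by (intro mult_left_mono) auto
    then have "exp (2 * \<mu> * t - 2 * \<mu> * T) * V T \<le> V t"
      by (simp add: W_def exp_minus exp_diff field_simps)
    moreover have "1 + (2 * \<mu> * t - 2 * \<mu> * T) \<le> exp (2 * \<mu> * t - 2 * \<mu> * T)"
      using exp_ge_add_one_self by simp
    then have "(1 + (2 * \<mu> * t - 2 * \<mu> * T)) * V T \<le> exp (2 * \<mu> * t - 2 * \<mu> * T) * V T"
      using VT by (intro mult_right_mono) auto
    moreover have "(1 + (2 * \<mu> * t - 2 * \<mu> * T)) * V T = V T + R"
      using VT \<mu> by (simp add: t_def field_simps)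
    ultimately have "V T + R \<le> V t" by linarith
    moreover have "V t \<le> R"
    proof -
      have nD: "norm (D t) \<le> 2 * r"
        using near[OF t] dist_triangle2[of "\<Psi> t" "\<Phi> t" P] by (simp add: D_def dist_norm)
      have "V t \<le> norm (D t) * norm (B (D t))" unfolding V_def by (rule norm_cauchy_schwarz)
      also have "\<dots> \<le> norm (D t) * (b * norm (D t))" by (intro mult_left_mono b) auto
      also have "\<dots> = b * (norm (D t))^2" by (simp add: power2_eq_square)
      also have "\<dots> \<le> R" unfolding R_def using nD b by (intro mult_left_mono power_mono) auto
      finally show ?thesis .
    qed
    ultimately show False using VT by simp
  qed
  have "v \<bullet> B v > 0" using v \<mu> by (simp add: B_def inner_diff_right vv)
  then show ?thesis
    unfolding v_def
  proof (rule that[OF u(1,2) linB _ r(1)], goal_cases)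
    case (1 \<Phi> \<Psi> T)
    then show ?case by (intro main[of \<Phi> \<Psi> T]) auto
  qed
qed

text \<open>Gronwall backwards in time: with L a Lipschitz constant of the gradient, exp (2 L t)
  times the squared distance of two solutions is nondecreasing. Initial values thus depend in a
  Lipschitz way on positions at time T.\<close>

lemma grad_flow_backward_Lipschitz:
  "\<exists>L>0. \<forall>\<Phi> \<Psi> :: real \<Rightarrow> real^'d::finite^'n::finite. \<forall>T\<ge>0.
     grad_flow_solution fobj \<Phi> \<longrightarrow> grad_flow_solution fobj \<Psi> \<longrightarrow> \<Phi> 0 \<in> sphere_prod \<longrightarrow> \<Psi> 0 \<in> sphere_prod \<longrightarrow>
       norm (\<Psi> 0 - \<Phi> 0) \<le> exp (L * T) * norm (\<Psi> T - \<Phi> T)"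
proof -
  obtain L where L: "L > 0" and Lip': "\<forall>X\<in>cball 0 (real CARD('n)). \<forall>Y\<in>cball 0 (real CARD('n)).
      norm (rgrad fobj Y - rgrad fobj (X :: real^'d^'n)) \<le> L * norm (Y - X)"
    using C1_Lipschitz_on_cball[OF rgrad_fobj_has_derivative continuous_on_rgrad_deriv] by blast
  have Lip: "norm (rgrad fobj Y - rgrad fobj X) \<le> L * norm (Y - X)"
    if "X \<in> sphere_prod" "Y \<in> sphere_prod" for X Y :: "real^'d^'n"
    using Lip' that sphere_prod_subset_cball by blast
  have "norm (\<Psi> 0 - \<Phi> 0) \<le> exp (L * T) * norm (\<Psi> T - \<Phi> T)"
    if sol: "grad_flow_solution fobj \<Phi>" "grad_flow_solution fobj \<Psi>"
      and init: "\<Phi> 0 \<in> sphere_prod" "\<Psi> 0 \<in> sphere_prod" and T: "T \<ge> 0"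
    for \<Phi> \<Psi> :: "real \<Rightarrow> real^'d^'n" and T
  proof -
    define D where "D t = \<Psi> t - \<Phi> t" for t
    define D' where "D' t = rgrad fobj (\<Psi> t) - rgrad fobj (\<Phi> t)" for t
    have D: "(D has_vector_derivative D' t) (at t within {0..})" if "t \<ge> 0" for t
      unfolding D_def[abs_def] D'_def
      by (intro has_vector_derivative_diff grad_flow_derivative sol that)
    have sq: "((\<lambda>t. D t \<bullet> D t) has_real_derivative 2 * (D t \<bullet> D' t)) (at t within {0..})" if "t \<ge> 0" for t
      using bounded_bilinear.has_vector_derivative[OF bounded_bilinear_inner D[OF that] D[OF that]]
      unfolding has_real_derivative_iff_has_vector_derivative by (simp add: inner_commute)
    have "exp (2 * L * 0) * (D 0 \<bullet> D 0) \<le> exp (2 * L * T) * (D T \<bullet> D T)"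
    proof (rule nonneg_derivative_imp_le[where a = 0 and g = "\<lambda>t. exp (2 * L * t) * (D t \<bullet> D t)"
          and g' = "\<lambda>t. exp (2 * L * t) * (2 * (D t \<bullet> D' t + L * (D t \<bullet> D t)))"])
      fix t :: real assume t: "t \<ge> 0"
      show "((\<lambda>t. exp (2 * L * t) * (D t \<bullet> D t)) has_real_derivative
          exp (2 * L * t) * (2 * (D t \<bullet> D' t + L * (D t \<bullet> D t)))) (at t within {0..})"
        by (auto intro!: derivative_eq_intros sq t simp: algebra_simps)
      have "norm (D' t) \<le> L * norm (D t)"
        unfolding D'_def D_def using t
        by (intro Lip grad_flow_in_sphere_prod[OF sol(1) init(1)] grad_flow_in_sphere_prod[OF sol(2) init(2)])
      then have "\<bar>D t \<bullet> D' t\<bar> \<le> norm (D t) * (L * norm (D t))"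
        using Cauchy_Schwarz_ineq2[of "D t" "D' t"] by (smt (verit) mult_left_mono norm_ge_zero)
      also have "\<dots> = L * (D t \<bullet> D t)" by (simp add: dot_square_norm power2_eq_square)
      finally have "D t \<bullet> D' t + L * (D t \<bullet> D t) \<ge> 0" by linarith
      then show "0 \<le> exp (2 * L * t) * (2 * (D t \<bullet> D' t + L * (D t \<bullet> D t)))" by simp
    qed (use T in auto)
    then have "(norm (D 0))^2 \<le> (exp (L * T) * norm (D T))^2"
      by (simp add: dot_square_norm power_mult_distrib exp_double[symmetric] mult.assoc)
    then have "norm (D 0) \<le> exp (L * T) * norm (D T)" by (rule power2_le_imp_le) simp
    then show ?thesis by (simp add: D_def)
  qed
  then show ?thesis using L by blast
qed

section \<open>Almost every trajectory converges to a maximiser\<close>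

text \<open>g is injective with Lipschitz inverse, so S is a Lipschitz image of a subset of a
  hyperplane. In the application g forgets the unstable coordinate at a later time.\<close>

lemma negligible_expanding_into_hyperplane:
  fixes g :: "'a::euclidean_space \<Rightarrow> 'a"
  assumes "a \<noteq> 0" and hyper: "\<And>x. x \<in> S \<Longrightarrow> a \<bullet> g x = 0"
    and expand: "\<And>x y. x \<in> S \<Longrightarrow> y \<in> S \<Longrightarrow> norm (x - y) \<le> L * norm (g x - g y)"
  shows "negligible S"
proof -
  have inj: "inj_on g S"
    using expand by (intro inj_onI) fastforce
  have "negligible (g ` S)"
    by (rule negligible_subset[OF negligible_hyperplane[of a 0]]) (use assms(1) hyper in auto)
  then have "negligible (inv_into S g ` (g ` S))"
  proof (rule negligible_locally_Lipschitz_image[OF order_refl])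
    fix x assume x: "x \<in> g ` S"
    show "\<exists>T B. open T \<and> x \<in> T \<and> (\<forall>y\<in>g ` S \<inter> T. norm (inv_into S g y - inv_into S g x) \<le> B * norm (y - x))"
      using x expand by (intro exI[of _ UNIV] exI[of _ L]) (auto simp: inv_into_f_f[OF inj])
  qed
  then show ?thesis by (simp add: inv_into_image_cancel[OF inj])
qed

text \<open>Positivity at v persists on a ball around v and, by homogeneity, on the double cone over
  it. Outside the cone the coefficient along v is controlled by the remainder: this is the
  Lipschitz-graph condition.\<close>

lemma quadratic_form_positive_cone:
  fixes B :: "'a::euclidean_space \<Rightarrow> 'a"
  assumes lin: "linear B" and pos: "v \<bullet> B v > 0"
  shows "\<exists>\<eta>>0. \<forall>\<tau> e. (\<tau> *\<^sub>R v + e) \<bullet> B (\<tau> *\<^sub>R v + e) \<le> 0 \<longrightarrow> \<eta> * \<bar>\<tau>\<bar> \<le> norm e"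
proof -
  have "continuous_on UNIV (\<lambda>w. w \<bullet> B w)"
    using lin by (intro continuous_intros linear_continuous_on) (simp add: linear_conv_bounded_linear)
  then have "open {w. w \<bullet> B w > 0}" by (intro open_Collect_less continuous_on_const) auto
  then obtain \<eta> where \<eta>: "\<eta> > 0" "ball v \<eta> \<subseteq> {w. w \<bullet> B w > 0}"
    using pos openE[of "{w. w \<bullet> B w > 0}" v] by blast
  have "\<eta> * \<bar>\<tau>\<bar> \<le> norm e" if le: "(\<tau> *\<^sub>R v + e) \<bullet> B (\<tau> *\<^sub>R v + e) \<le> 0" for \<tau> e
  proof (rule ccontr)
    assume "\<not> ?thesis"
    then have less: "norm e < \<eta> * \<bar>\<tau>\<bar>" by simp
    then have \<tau>: "\<tau> \<noteq> 0" by auto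
    define w where "w = v + e /\<^sub>R \<tau>"
    have "w \<in> ball v \<eta>" using less \<tau> by (simp add: w_def dist_norm field_simps)
    then have "w \<bullet> B w > 0" using \<eta>(2) by blast
    moreover have "\<tau> *\<^sub>R v + e = \<tau> *\<^sub>R w" using \<tau> by (simp add: w_def scaleR_add_right)
    then have "(\<tau> *\<^sub>R v + e) \<bullet> B (\<tau> *\<^sub>R v + e) = \<tau>^2 * (w \<bullet> B w)"
      by (simp add: linear_scale[OF lin] power2_eq_square)
    ultimately show False using le \<tau> by (simp add: mult_le_0_iff)
  qed
  then show ?thesis using \<eta>(1) by blast
qed

text \<open>Radii and directions are recovered from the vectors in a Lipschitz way; the factor 2
  pays for replacing the radius s of y by r.\<close>

lemma scaled_unit_vectors:
  fixes x y :: "'a::real_inner"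
  assumes "norm x = 1" "norm y = 1" "0 \<le> r" "0 \<le> s"
  shows "\<bar>s - r\<bar> \<le> norm (s *\<^sub>R y - r *\<^sub>R x)" "r * norm (y - x) \<le> 2 * norm (s *\<^sub>R y - r *\<^sub>R x)"
proof -
  show 1: "\<bar>s - r\<bar> \<le> norm (s *\<^sub>R y - r *\<^sub>R x)"
    using norm_triangle_ineq3[of "s *\<^sub>R y" "r *\<^sub>R x"] assms by simp
  have "r * norm (y - x) = norm (r *\<^sub>R (y - x))" using assms by simp
  also have "r *\<^sub>R (y - x) = (s *\<^sub>R y - r *\<^sub>R x) - (s - r) *\<^sub>R y" by (simp add: algebra_simps)
  also have "norm \<dots> \<le> norm (s *\<^sub>R y - r *\<^sub>R x) + \<bar>s - r\<bar>"
    using norm_triangle_ineq4[of "s *\<^sub>R y - r *\<^sub>R x" "(s - r) *\<^sub>R y"] assms by simp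
  finally show "r * norm (y - x) \<le> 2 * norm (s *\<^sub>R y - r *\<^sub>R x)" using 1 by simp
qed

text \<open>Undoes \<open>col_normalize\<close> when r holds the column norms, and so carries points
  of the product of spheres back to the space in which null sets are measured.\<close>

definition scale_columns :: "('n \<Rightarrow> real) \<Rightarrow> real^'d^'n \<Rightarrow> real^'d^'n" where
  "scale_columns r X = (\<chi> j. r j *\<^sub>R X$j)"

lemma scale_columns_nth [simp]: "scale_columns r X $ j = r j *\<^sub>R X$j"
  by (simp add: scale_columns_def)

text \<open>Since $u \perp p_i$, moving the scaled configuration along $u$ in column $i$ changes the radius
  of that column only to second order.\<close>
lemma unscaled_difference_near_column_direction:
  fixes X Y P :: "real^'d::finite^'n::finite"
  assumes X: "X \<in> sphere_prod" "dist X P < \<rho>" and Y: "Y \<in> sphere_prod" "dist Y P < \<rho>"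
    and u: "norm u = 1" "P$i \<bullet> u = 0" and "M \<ge> 1"
    and r: "\<And>j. 1 / M \<le> r j" "\<And>j. r j \<le> M" and s: "\<And>j. 1 / M \<le> s j"
  defines "v \<equiv> \<chi> k. if k = i then u else 0"
    and "\<Delta> \<equiv> scale_columns s Y - scale_columns r X"
  defines "\<tau> \<equiv> \<Delta> $ i \<bullet> u"
  defines "\<omega> \<equiv> \<Delta> - \<tau> *\<^sub>R v"
  shows "norm (r i *\<^sub>R (Y - X) - \<tau> *\<^sub>R v) \<le> real CARD('n) * (\<rho> * \<bar>\<tau>\<bar> + 2 * M^2 * norm \<omega>)"
proof (rule norm_le_columns)
  fix j
  have pos: "r j > 0" "s j > 0" for j
    using r(1)[of j] s[of j] \<open>M \<ge> 1\<close> by (auto intro: less_le_trans[of 0 "1/M"])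
  have \<Delta>_nth: "\<Delta> $ j = s j *\<^sub>R Y$j - r j *\<^sub>R X$j" for j by (simp add: \<Delta>_def)
  have \<omega>_le: "norm (\<omega> $ j) \<le> norm \<omega>" for j by (rule Finite_Cartesian_Product.norm_nth_le)
  have \<rho>0: "\<rho> > 0" using X(2) zero_le_dist[of X P] by linarith
  show "norm ((r i *\<^sub>R (Y - X) - \<tau> *\<^sub>R v) $ j) \<le> \<rho> * \<bar>\<tau>\<bar> + 2 * M^2 * norm \<omega>"
  \<comment> \<open>Away from column i the vector v vanishes, so \<open>\<Delta>\<close> and
    \<open>\<omega>\<close> agree, and the bounds 1/M and M on the radii suffice. Column i needs
    control of the change of radius b - a.\<close>
  proof (cases "j = i")
    case False
    have "(1 / M) * norm (Y$j - X$j) \<le> r j * norm (Y$j - X$j)" using r(1) by (intro mult_right_mono) auto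
    also have "\<dots> \<le> 2 * norm (\<Delta> $ j)"
      unfolding \<Delta>_nth using pos[of j] X Y by (intro scaled_unit_vectors) (auto simp: sphere_prodD)
    also have "\<Delta> $ j = \<omega> $ j" using False by (simp add: \<omega>_def v_def)
    finally have "norm (Y$j - X$j) \<le> 2 * M * norm (\<omega> $ j)" using \<open>M \<ge> 1\<close> by (simp add: field_simps)
    then have "r i * norm (Y$j - X$j) \<le> M * (2 * M * norm (\<omega> $ j))"
      using r(2)[of i] pos(1)[of i] \<open>M \<ge> 1\<close> by (intro mult_mono) auto
    also have "\<dots> \<le> M * (2 * M * norm \<omega>)" using \<omega>_le \<open>M \<ge> 1\<close> by (intro mult_left_mono) auto
    also have "\<dots> = 2 * M^2 * norm \<omega>" by (simp add: power2_eq_square)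
    also have "\<dots> \<le> \<rho> * \<bar>\<tau>\<bar> + 2 * M^2 * norm \<omega>" using \<rho>0 by simp
    finally show ?thesis using False pos(1)[of i] by (simp add: v_def)
  next
    case True
    define x y a b where "x = X$i" and "y = Y$i" and "a = r i" and "b = s i"
    have ab: "a > 0" "b > 0" using pos by (auto simp: a_def b_def)
    have xy: "norm x = 1" "norm y = 1" using X Y by (auto simp: x_def y_def sphere_prodD)
    have \<Delta>i: "\<Delta> $ i = b *\<^sub>R y - a *\<^sub>R x" by (simp add: \<Delta>_nth x_def y_def a_def b_def)
    have \<omega>i: "\<omega> $ i = b *\<^sub>R y - a *\<^sub>R x - \<tau> *\<^sub>R u" by (simp add: \<omega>_def v_def \<Delta>i)
    have perp: "\<bar>z \<bullet> u\<bar> \<le> \<rho>" if "norm (z - P$i) \<le> \<rho>" for z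
    proof -
      have "z \<bullet> u = (z - P$i) \<bullet> u" using u by (simp add: inner_diff_left)
      then show ?thesis using Cauchy_Schwarz_ineq2[of "z - P$i" u] u that by simp
    qed
    have "\<bar>x \<bullet> u\<bar> \<le> \<rho>" "\<bar>y \<bullet> u\<bar> \<le> \<rho>"
      using X(2) Y(2) Finite_Cartesian_Product.norm_nth_le[of "X - P" i]
        Finite_Cartesian_Product.norm_nth_le[of "Y - P" i]
      by (auto intro!: perp simp: x_def y_def dist_norm)
    then have "\<bar>b * (y \<bullet> u)\<bar> \<le> b * \<rho>" "\<bar>a * (x \<bullet> u)\<bar> \<le> a * \<rho>"
      using ab by (simp_all add: abs_mult)
    then have "\<bar>b * (y \<bullet> u) + a * (x \<bullet> u)\<bar> \<le> b * \<rho> + a * \<rho>" by linarith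
    then have 1: "\<bar>\<tau> * (b * (y \<bullet> u) + a * (x \<bullet> u))\<bar> \<le> \<bar>\<tau>\<bar> * (b * \<rho> + a * \<rho>)"
      by (simp add: abs_mult mult_left_mono)
    have "norm (b *\<^sub>R y + a *\<^sub>R x) \<le> b + a"
      using norm_triangle_ineq[of "b *\<^sub>R y" "a *\<^sub>R x"] ab xy by simp
    then have 2: "\<bar>(b *\<^sub>R y + a *\<^sub>R x) \<bullet> \<omega> $ i\<bar> \<le> (b + a) * norm \<omega>"
      using Cauchy_Schwarz_ineq2[of "b *\<^sub>R y + a *\<^sub>R x" "\<omega> $ i"] \<omega>_le[of i] ab
        mult_mono[of "norm (b *\<^sub>R y + a *\<^sub>R x)" "b + a" "norm (\<omega> $ i)" "norm \<omega>"] by simp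
    have "x \<bullet> x = 1" "y \<bullet> y = 1" using xy by (simp_all add: dot_square_norm)
    \<comment> \<open>Writing b^2 - a^2 as |b y|^2 - |a x|^2 brings in b y + a x, whose product with
      u is at most (a + b) \<open>\<rho>\<close> because u is orthogonal to p_i. Division by a + b
      bounds |b - a|.\<close>
    then have "(b + a) * (b - a) = (b *\<^sub>R y + a *\<^sub>R x) \<bullet> (b *\<^sub>R y - a *\<^sub>R x)"
      by (simp add: inner_add_left inner_diff_right inner_commute[of y x] algebra_simps)
    also have "b *\<^sub>R y - a *\<^sub>R x = \<tau> *\<^sub>R u + \<omega> $ i" by (simp add: \<omega>i)
    also have "(b *\<^sub>R y + a *\<^sub>R x) \<bullet> (\<tau> *\<^sub>R u + \<omega> $ i)
        = \<tau> * (b * (y \<bullet> u) + a * (x \<bullet> u)) + (b *\<^sub>R y + a *\<^sub>R x) \<bullet> \<omega> $ i"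
      by (simp add: inner_add_right) (simp add: inner_add_left algebra_simps)
    finally have "\<bar>(b + a) * (b - a)\<bar> \<le> \<bar>\<tau>\<bar> * (b * \<rho> + a * \<rho>) + (b + a) * norm \<omega>"
      using 1 2 by linarith
    also have "\<dots> = (b + a) * (\<rho> * \<bar>\<tau>\<bar> + norm \<omega>)" by (simp add: algebra_simps)
    finally have ba: "\<bar>b - a\<bar> \<le> \<rho> * \<bar>\<tau>\<bar> + norm \<omega>" using ab by (simp add: abs_mult)
    have "a *\<^sub>R (y - x) - \<tau> *\<^sub>R u = \<omega> $ i - (b - a) *\<^sub>R y" by (simp add: \<omega>i algebra_simps)
    then have "norm (a *\<^sub>R (y - x) - \<tau> *\<^sub>R u) \<le> norm \<omega> + \<bar>b - a\<bar>"
      using norm_triangle_ineq4[of "\<omega> $ i" "(b - a) *\<^sub>R y"] \<omega>_le[of i] xy by simp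
    also have "\<dots> \<le> \<rho> * \<bar>\<tau>\<bar> + 2 * norm \<omega>" using ba by simp
    also have "2 * norm \<omega> \<le> 2 * M^2 * norm \<omega>"
      using \<open>M \<ge> 1\<close> by (intro mult_right_mono) (auto simp: one_le_power)
    finally show ?thesis using True by (simp add: v_def x_def y_def a_def)
  qed
qed

text \<open>k fixes the time from which the solution stays in U, and m keeps the column norms away
  from 0 and infinity. For fixed k and m all constants are uniform, and countably many pairs exhaust
  all cases.\<close>

definition trapped_initial_data :: "(real^'d::finite^'n::finite) set \<Rightarrow> nat \<Rightarrow> nat \<Rightarrow> (real^'d^'n) set" where
  "trapped_initial_data U k m = {Z. (\<forall>j. 1 / real (Suc m) \<le> norm (Z$j) \<and> norm (Z$j) \<le> real (Suc m)) \<and>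
     (\<exists>\<Phi>. grad_flow_solution fobj \<Phi> \<and> \<Phi> 0 = col_normalize Z \<and> (\<forall>t\<ge>real k. \<Phi> t \<in> U))}"

lemma col_normalize_in_sphere_prod:
  assumes "\<And>j. Z$j \<noteq> 0"
  shows "col_normalize Z \<in> sphere_prod"
  using assms by (simp add: col_normalize_def sphere_prod_def)

lemma scale_col_normalize:
  assumes "\<And>j. Z$j \<noteq> 0"
  shows "scale_columns (\<lambda>j. norm (Z$j)) (col_normalize Z) = Z"
  using assms by (simp add: col_normalize_def columns_eq_iff)

text \<open>Z is sent to its position at time k, rescaled by the column norms of Z, and the
  component along v is deleted. The cone condition shows that the deletion costs a constant factor
  (\<open>step1\<close>), the backward estimate that Z can be recovered
  (\<open>step2\<close>).\<close>

lemma negligible_trapped_initial_data: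
  fixes P :: "real^'d::finite^'n::finite"
  assumes P: "P \<in> sphere_prod" and crit: "rgrad fobj P = 0" and nmax: "\<not> global_max_on_M fobj P"
  shows "\<exists>U. open U \<and> P \<in> U \<and> (\<forall>k m. negligible (trapped_initial_data U k m))"
proof -
  obtain i u B r0 where u: "norm u = 1" "P$i \<bullet> u = 0" and linB: "linear B"
    and pos: "(\<chi> k. if k = i then u else 0) \<bullet> B (\<chi> k. if k = i then u else 0) > 0" and r0: "r0 > 0"
    and cone: "\<And>\<Phi> \<Psi> T. grad_flow_solution fobj \<Phi> \<Longrightarrow> grad_flow_solution fobj \<Psi> \<Longrightarrow>
       \<Phi> 0 \<in> sphere_prod \<Longrightarrow> \<Psi> 0 \<in> sphere_prod \<Longrightarrow> T \<ge> 0 \<Longrightarrow>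
       (\<And>t. t \<ge> T \<Longrightarrow> dist (\<Phi> t) P < r0) \<Longrightarrow> (\<And>t. t \<ge> T \<Longrightarrow> dist (\<Psi> t) P < r0) \<Longrightarrow>
       (\<Psi> T - \<Phi> T) \<bullet> B (\<Psi> T - \<Phi> T) \<le> 0"
  proof (rule unstable_form[OF assms], goal_cases)
    case (1 i u B r)
    show ?case
      by (rule that[of u i B r]) (use 1 in simp_all)
  qed
  define v :: "real^'d^'n" where "v = (\<chi> k. if k = i then u else 0)"
  obtain \<eta> where \<eta>: "\<eta> > 0"
    "\<And>\<tau> e. (\<tau> *\<^sub>R v + e) \<bullet> B (\<tau> *\<^sub>R v + e) \<le> 0 \<Longrightarrow> \<eta> * \<bar>\<tau>\<bar> \<le> norm e"
    using quadratic_form_positive_cone[OF linB pos] unfolding v_def by blast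
  obtain L where L: "\<And>\<Phi> \<Psi> :: real \<Rightarrow> real^'d^'n. \<And>T. T \<ge> 0 \<Longrightarrow> grad_flow_solution fobj \<Phi> \<Longrightarrow>
       grad_flow_solution fobj \<Psi> \<Longrightarrow> \<Phi> 0 \<in> sphere_prod \<Longrightarrow> \<Psi> 0 \<in> sphere_prod \<Longrightarrow>
       norm (\<Psi> 0 - \<Phi> 0) \<le> exp (L * T) * norm (\<Psi> T - \<Phi> T)"
    using grad_flow_backward_Lipschitz[where 'd='d and 'n='n] by blast
  define n where "n = real CARD('n)"
  have n: "n \<ge> 1" using zero_less_card_finite[where 'a='n] by (simp add: n_def)
  \<comment> \<open>With n \<open>\<rho>\<close> at most half of \<open>\<eta>\<close>, the error n
    \<open>\<rho> * \<bar>\<tau>\<bar>\<close> in \<open>step1\<close> is absorbed by the left-hand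
    side.\<close>
  define \<rho> where "\<rho> = min r0 (\<eta> / (2 * n))"
  have \<rho>: "\<rho> > 0" "\<rho> \<le> r0" "n * \<rho> \<le> \<eta> / 2"
    using r0 \<eta>(1) n by (auto simp: \<rho>_def min_def field_simps)
  have single: "v \<bullet> Z = u \<bullet> Z$i" for Z :: "real^'d^'n"
  proof -
    have "v \<bullet> Z = (\<Sum>k\<in>UNIV. if k = i then u \<bullet> Z$k else 0)"
      unfolding inner_columns by (intro sum.cong) (auto simp: v_def)
    then show ?thesis by simp
  qed
  have vv: "v \<bullet> v = 1" using u by (simp add: single) (simp add: v_def dot_square_norm)
  then have nv: "norm v = 1" by (simp add: norm_eq_sqrt_inner)
  have "negligible (trapped_initial_data (ball P \<rho>) k m)" for k m
  proof -
    define S where "S = trapped_initial_data (ball P \<rho>) k m"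
    define M where "M = real (Suc m)"
    have M: "M \<ge> 1" by (simp add: M_def)
    have "\<forall>Z\<in>S. \<exists>\<Phi>. grad_flow_solution fobj \<Phi> \<and> \<Phi> 0 = col_normalize Z \<and> (\<forall>t\<ge>real k. \<Phi> t \<in> ball P \<rho>)"
      by (auto simp: S_def trapped_initial_data_def)
    then obtain \<Phi> where \<Phi>: "\<And>Z. Z \<in> S \<Longrightarrow> grad_flow_solution fobj (\<Phi> Z)"
      "\<And>Z. Z \<in> S \<Longrightarrow> \<Phi> Z 0 = col_normalize Z"
      "\<And>Z t. Z \<in> S \<Longrightarrow> t \<ge> real k \<Longrightarrow> dist (\<Phi> Z t) P < \<rho>"
      unfolding mem_ball dist_commute[of P] by metis
    have radii: "1 / M \<le> norm (Z$j)" "norm (Z$j) \<le> M" if "Z \<in> S" for Z j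
      using that by (auto simp: S_def trapped_initial_data_def M_def)
    have nz: "Z$j \<noteq> 0" if "Z \<in> S" for Z j
      using radii(1)[OF that, of j] M by auto
    have init: "\<Phi> Z 0 \<in> sphere_prod" if "Z \<in> S" for Z
      using \<Phi>(2) col_normalize_in_sphere_prod nz that by metis
    have sph: "\<Phi> Z (real k) \<in> sphere_prod" if "Z \<in> S" for Z
      by (rule grad_flow_in_sphere_prod[OF \<Phi>(1)[OF that] init[OF that]]) simp
    define A where "A Z = scale_columns (\<lambda>j. norm (Z$j)) (\<Phi> Z (real k))" for Z
    define C where "C = 2 * n * 2 * M^2 / \<eta> + 1"
    define E where "E = exp (L * real k)"
    have step1: "norm (A Y - A Z) \<le> C * norm ((A Y - A Z) - ((A Y - A Z) $ i \<bullet> u) *\<^sub>R v)"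
      if Z: "Z \<in> S" and Y: "Y \<in> S" for Y Z
    proof -
      define \<tau> where "\<tau> = (A Y - A Z) $ i \<bullet> u"
      define q where "q = norm ((A Y - A Z) - \<tau> *\<^sub>R v)"
      define D where "D = \<Phi> Y (real k) - \<Phi> Z (real k)"
      define a where "a = norm (Z$i)"
      have "D \<bullet> B D \<le> 0"
        unfolding D_def using \<rho>(2)
        by (intro cone \<Phi>(1) init Z Y) (auto intro: less_le_trans[OF \<Phi>(3)[OF Z]] less_le_trans[OF \<Phi>(3)[OF Y]])
      \<comment> \<open>The form is homogeneous, so D may be multiplied by the radius of column i to
        match \<open>unscaled_difference_near_column_direction\<close>.\<close>
      then have "(a *\<^sub>R D) \<bullet> B (a *\<^sub>R D) \<le> 0"
        by (simp add: linear_scale[OF linB] a_def mult_nonneg_nonpos)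
      then have "(\<tau> *\<^sub>R v + (a *\<^sub>R D - \<tau> *\<^sub>R v)) \<bullet> B (\<tau> *\<^sub>R v + (a *\<^sub>R D - \<tau> *\<^sub>R v)) \<le> 0" by simp
      then have "\<eta> * \<bar>\<tau>\<bar> \<le> norm (a *\<^sub>R D - \<tau> *\<^sub>R v)" by (rule \<eta>(2))
      also have "\<dots> \<le> n * (\<rho> * \<bar>\<tau>\<bar> + 2 * M^2 * q)"
        unfolding a_def D_def \<tau>_def q_def A_def v_def n_def
        by (rule unscaled_difference_near_column_direction[OF sph[OF Z] \<Phi>(3)[OF Z order_refl]
              sph[OF Y] \<Phi>(3)[OF Y order_refl] u M radii(1)[OF Z] radii(2)[OF Z] radii(1)[OF Y]])
      also have "\<dots> = (n * \<rho>) * \<bar>\<tau>\<bar> + n * 2 * M^2 * q" by (simp add: algebra_simps)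
      also have "\<dots> \<le> (\<eta> / 2) * \<bar>\<tau>\<bar> + n * 2 * M^2 * q"
        using \<rho>(3) by (intro add_right_mono mult_right_mono) auto
      finally have "(\<eta> / 2) * \<bar>\<tau>\<bar> \<le> n * 2 * M^2 * q" by simp
      then have \<tau>q: "\<bar>\<tau>\<bar> \<le> 2 * n * 2 * M^2 / \<eta> * q" using \<eta>(1) by (simp add: field_simps)
      have "norm (A Y - A Z) \<le> q + \<bar>\<tau>\<bar>"
        using norm_triangle_ineq[of "(A Y - A Z) - \<tau> *\<^sub>R v" "\<tau> *\<^sub>R v"] by (simp add: q_def nv)
      also have "\<dots> \<le> C * q" using \<tau>q by (simp add: C_def algebra_simps)
      finally show ?thesis unfolding q_def \<tau>_def .
    qed
    have step2: "norm (Y - Z) \<le> n * (1 + M * (E * (n * (2 * M)))) * norm (A Y - A Z)"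
      if Z: "Z \<in> S" and Y: "Y \<in> S" for Y Z
    proof -
      have col: "norm ((A Y - A Z) $ j) \<le> norm (A Y - A Z)" for j
        by (rule Finite_Cartesian_Product.norm_nth_le)
      have "norm ((\<Phi> Y (real k) - \<Phi> Z (real k)) $ j) \<le> 2 * M * norm (A Y - A Z)" for j
      proof -
        have "(1 / M) * norm ((\<Phi> Y (real k) - \<Phi> Z (real k)) $ j)
            \<le> norm (Z$j) * norm (\<Phi> Y (real k) $ j - \<Phi> Z (real k) $ j)"
          unfolding vector_minus_component by (intro mult_right_mono radii(1)[OF Z]) auto
        also have "\<dots> \<le> 2 * norm ((A Y - A Z) $ j)"
          using scaled_unit_vectors(2)[OF sphere_prodD[OF sph[OF Z]] sphere_prodD[OF sph[OF Y]], of "norm (Z$j)" "norm (Y$j)" j j]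
          by (simp add: A_def)
        also have "\<dots> \<le> 2 * norm (A Y - A Z)" using col by simp
        finally show ?thesis using M by (simp add: field_simps)
      qed
      then have "norm (\<Phi> Y (real k) - \<Phi> Z (real k)) \<le> n * (2 * M * norm (A Y - A Z))"
        unfolding n_def by (rule norm_le_columns)
      then have "E * norm (\<Phi> Y (real k) - \<Phi> Z (real k)) \<le> E * (n * (2 * M * norm (A Y - A Z)))"
        unfolding E_def by (intro mult_left_mono) auto
      then have backward: "norm (\<Phi> Y 0 - \<Phi> Z 0) \<le> E * (n * (2 * M * norm (A Y - A Z)))"
        using L[OF of_nat_0_le_iff[of k] \<Phi>(1)[OF Z] \<Phi>(1)[OF Y] init[OF Z] init[OF Y]]
        unfolding E_def by (rule order_trans[rotated])
      have "norm ((Y - Z) $ j) \<le> norm (A Y - A Z) + M * (E * (n * (2 * M * norm (A Y - A Z))))" for j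
      proof -
        have eq: "Y$j = norm (Y$j) *\<^sub>R \<Phi> Y 0 $ j" "Z$j = norm (Z$j) *\<^sub>R \<Phi> Z 0 $ j"
          using arg_cong[OF scale_col_normalize[OF nz[OF Y]], of "\<lambda>X. X $ j"]
            arg_cong[OF scale_col_normalize[OF nz[OF Z]], of "\<lambda>X. X $ j"]
          by (simp_all only: scale_columns_nth \<Phi>(2)[OF Y] \<Phi>(2)[OF Z])
        define y z where "y = \<Phi> Y 0 $ j" and "z = \<Phi> Z 0 $ j"
        have "(Y - Z) $ j = norm (Y$j) *\<^sub>R y - norm (Z$j) *\<^sub>R z"
          unfolding y_def z_def eq[symmetric] by simp
        also have "\<dots> = (norm (Y$j) - norm (Z$j)) *\<^sub>R y + norm (Z$j) *\<^sub>R (y - z)"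
          by (simp add: algebra_simps)
        finally have "norm ((Y - Z) $ j) \<le> norm ((norm (Y$j) - norm (Z$j)) *\<^sub>R y) + norm (norm (Z$j) *\<^sub>R (y - z))"
          using norm_triangle_ineq by metis
        also have "\<dots> = \<bar>norm (Y$j) - norm (Z$j)\<bar> + norm (Z$j) * norm (y - z)"
          using sphere_prodD[OF init[OF Y]] by (simp add: y_def)
        also have "\<bar>norm (Y$j) - norm (Z$j)\<bar> \<le> norm (A Y - A Z)"
          using scaled_unit_vectors(1)[OF sphere_prodD[OF sph[OF Z]] sphere_prodD[OF sph[OF Y]], of "norm (Z$j)" "norm (Y$j)" j j]
            col[of j] by (simp add: A_def)
        also have "norm (Z$j) * norm (y - z) \<le> M * (E * (n * (2 * M * norm (A Y - A Z))))"
        proof (rule mult_mono)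
          show "norm (y - z) \<le> E * (n * (2 * M * norm (A Y - A Z)))"
            using Finite_Cartesian_Product.norm_nth_le[of "\<Phi> Y 0 - \<Phi> Z 0" j] backward by (simp add: y_def z_def)
        qed (use radii(2)[OF Z] M in auto)
        finally show ?thesis by simp
      qed
      then have "norm (Y - Z) \<le> n * (norm (A Y - A Z) + M * (E * (n * (2 * M * norm (A Y - A Z)))))"
        unfolding n_def by (rule norm_le_columns)
      then show ?thesis by (simp add: algebra_simps)
    qed
    have "negligible S"
    proof (rule negligible_expanding_into_hyperplane)
      show "v \<noteq> 0" using nv by auto
      show "v \<bullet> (A Z - (A Z $ i \<bullet> u) *\<^sub>R v) = 0" for Z
        by (simp add: inner_diff_right vv) (simp add: single inner_commute)
      fix Y Z assume YZ: "Y \<in> S" "Z \<in> S"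
      let ?K = "n * (1 + M * (E * (n * (2 * M))))"
      have "?K \<ge> 0" using n M by (simp add: E_def)
      then have "norm (Y - Z) \<le> ?K * (C * norm ((A Y - A Z) - ((A Y - A Z) $ i \<bullet> u) *\<^sub>R v))"
        using step2[OF YZ(2,1)] step1[OF YZ(2,1)] mult_left_mono order_trans by blast
      also have "(A Y - A Z) - ((A Y - A Z) $ i \<bullet> u) *\<^sub>R v = (A Y - (A Y $ i \<bullet> u) *\<^sub>R v) - (A Z - (A Z $ i \<bullet> u) *\<^sub>R v)"
        by (simp add: inner_diff_left algebra_simps)
      finally show "norm (Y - Z) \<le> (?K * C) * norm ((A Y - (A Y $ i \<bullet> u) *\<^sub>R v) - (A Z - (A Z $ i \<bullet> u) *\<^sub>R v))"
        by (simp only: mult.assoc)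
    qed
    then show ?thesis by (simp add: S_def)
  qed
  then show ?thesis using \<rho>(1) by (intro exI[of _ "ball P \<rho>"]) auto
qed

text \<open>These Z are set aside because \<open>col_normalize\<close> maps a zero column to 0 and
  so leaves the product of spheres. Fixing any one coordinate of the zero column places them in
  finitely many hyperplanes.\<close>

lemma negligible_zero_column: "negligible {Z :: real^'d::finite^'n::finite. \<exists>j. Z$j = 0}"
proof -
  obtain k :: 'd where True by simp
  have "{Z :: real^'d^'n. \<exists>j. Z$j = 0} \<subseteq> (\<Union>j. {Z. axis j (axis k 1) \<bullet> Z = 0})"
    by (auto simp: inner_axis') (metis zero_index)
  moreover have "negligible (\<Union>j::'n. {Z :: real^'d^'n. axis j (axis k 1) \<bullet> Z = 0})"
    by (intro negligible_Union) (auto simp: axis_eq_0_iff intro!: negligible_hyperplane)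
  ultimately show ?thesis using negligible_subset by blast
qed

lemma AE_grad_flow_converges_to_global_max:
  "AE Z in lborel. \<forall>\<Phi>. grad_flow_solution fobj \<Phi> \<and> \<Phi> 0 = col_normalize (Z::real^'d::finite^'n::finite)
            \<longrightarrow> (\<exists>Xlim. (\<Phi> \<longlongrightarrow> Xlim) at_top \<and> global_max_on_M fobj Xlim)"
proof -
  define \<F> :: "(real^'d^'n) set set" where
    "\<F> = {U. open U \<and> (\<forall>k m. negligible (trapped_initial_data U k m))}"
  obtain \<G> where \<G>: "\<G> \<subseteq> \<F>" "countable \<G>" "\<Union>\<G> = \<Union>\<F>"
    using Lindelof[of \<F>] by (auto simp: \<F>_def)
  define N where "N = {Z :: real^'d^'n. \<exists>j. Z$j = 0} \<union> (\<Union>U\<in>\<G>. \<Union>k m. trapped_initial_data U k m)"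
  have "negligible (\<Union>m. trapped_initial_data U k m)" if "U \<in> \<G>" for U k
    using that \<G>(1) by (intro negligible_countable_Union) (auto simp: \<F>_def)
  then have "negligible (\<Union>k. \<Union>m. trapped_initial_data U k m)" if "U \<in> \<G>" for U
    using that by (intro negligible_countable_Union) auto
  then have "negligible (\<Union>U\<in>\<G>. \<Union>k m. trapped_initial_data U k m)"
    using \<G>(2) by (intro negligible_countable_Union) auto
  then have "negligible N"
    unfolding N_def by (intro negligible_Un negligible_zero_column)
  then have "N \<in> null_sets lebesgue" by (simp add: negligible_iff_null_sets)
  then have "AE Z in lebesgue. Z \<notin> N" by (rule AE_not_in)
  \<comment> \<open>\<open>N\<close> is a null set of the completed measure and need not be Borel;
    almost-everywhere statements transfer from the completion.\<close>
  then have "AE Z in lborel. Z \<notin> N" by (simp add: AE_completion_iff)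
  then show ?thesis
  proof (rule AE_mp, intro AE_I2 impI allI, elim conjE)
    fix Z :: "real^'d^'n" and \<Phi>
    assume Z: "Z \<notin> N" and sol: "grad_flow_solution fobj \<Phi>" and init: "\<Phi> 0 = col_normalize Z"
    have nz: "Z$j \<noteq> 0" for j using Z by (auto simp: N_def)
    then have sph: "\<Phi> 0 \<in> sphere_prod" using init col_normalize_in_sphere_prod by metis
    obtain p where p: "p \<in> sphere_prod" "rgrad fobj p = 0" "(\<Phi> \<longlongrightarrow> p) at_top"
      using grad_flow_converges_to_critical[OF sol sph] .
    have "global_max_on_M fobj p"
    proof (rule ccontr)
      assume "\<not> global_max_on_M fobj p"
      then have "p \<in> \<Union>\<F>"
        using negligible_trapped_initial_data[OF p(1,2)] by (auto simp: \<F>_def)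
      then obtain U where U: "U \<in> \<G>" "p \<in> U" using \<G>(3) by blast
      then have "open U" using \<G>(1) by (auto simp: \<F>_def)
      then have "\<forall>\<^sub>F t in at_top. \<Phi> t \<in> U" using topological_tendstoD[OF p(3)] U(2) by blast
      then obtain T where T: "\<And>t. t \<ge> T \<Longrightarrow> \<Phi> t \<in> U" unfolding eventually_at_top_linorder by blast
      obtain k where k: "T \<le> real k" using real_arch_simple by blast
      \<comment> \<open>There are finitely many columns, all nonzero, so a single m bounds every
        norm from both sides.\<close>
      have "\<exists>m. \<forall>j. 1 / real (Suc m) \<le> norm (Z$j) \<and> norm (Z$j) \<le> real (Suc m)"
      proof -
        have "\<forall>\<^sub>F m in sequentially. 1 / real (Suc m) < norm (Z$j)" for j
          using order_tendstoD(2)[OF LIMSEQ_inverse_real_of_nat, of "norm (Z$j)"] nz by (simp add: inverse_eq_divide)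
        moreover have "\<forall>\<^sub>F m in sequentially. norm (Z$j) \<le> real (Suc m)" for j
          using filterlim_compose[OF filterlim_real_sequentially filterlim_Suc]
          by (simp add: filterlim_at_top)
        ultimately have "\<forall>\<^sub>F m in sequentially. 1 / real (Suc m) \<le> norm (Z$j) \<and> norm (Z$j) \<le> real (Suc m)" for j
          by (smt (verit) eventually_elim2)
        then have "\<forall>\<^sub>F m in sequentially. \<forall>j. 1 / real (Suc m) \<le> norm (Z$j) \<and> norm (Z$j) \<le> real (Suc m)"
          by (rule eventually_all_finite)
        then show ?thesis unfolding eventually_sequentially by blast
      qed
      then obtain m where "\<forall>j. 1 / real (Suc m) \<le> norm (Z$j) \<and> norm (Z$j) \<le> real (Suc m)" by blast
      then have "Z \<in> trapped_initial_data U k m"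
        unfolding trapped_initial_data_def using sol init T k by auto
      then show False using Z U(1) by (auto simp: N_def)
    qed
    then show "\<exists>Xlim. (\<Phi> \<longlongrightarrow> Xlim) at_top \<and> global_max_on_M fobj Xlim" using p(3) by blast
  qed
qed

theorem mainTheorem8:
  assumes "CARD('d::finite) \<ge> 2"
  shows "(\<forall>X::real^'d^'n::finite. X \<in> sphere_prod \<and> rgrad fobj X = 0 \<and> rhess_nsd fobj X
            \<longrightarrow> global_max_on_M fobj X)
     \<and> (\<forall>X::real^'d^'n. local_max_on_M fobj X \<longrightarrow> global_max_on_M fobj X)
     \<and> (\<forall>X::real^'d^'n. X \<in> sphere_prod \<longrightarrow>
            (global_max_on_M fobj X \<longleftrightarrow> (\<forall>i j. X$i = X$j \<or> X$i = - X$j)))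
     \<and> (AE Z in lborel. \<forall>\<Phi>. grad_flow_solution fobj \<Phi> \<and> \<Phi> 0 = col_normalize (Z::real^'d^'n)
            \<longrightarrow> (\<exists>Xlim. (\<Phi> \<longlongrightarrow> Xlim) at_top \<and> global_max_on_M fobj Xlim))"
  using second_order_critical_imp_global_max local_max_imp_global_max global_max_fobj_iff
    AE_grad_flow_converges_to_global_max by blast

end
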